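(* Let $r\ge1$ and let $(\mathbf x[r],\mathbf y)=(\mathbf x_1,\dots,\mathbf x_r,\mathbf y)\in(S^k)^{r+1}$ be a perfect sequence (with $r+1\le C\ell$). Then \[ Q_{[r]}(\mathbf y)\le p-\sqrt{\tfrac{k}{2\pi}}\,e^{-c^2/2}\,\mathbb E_{\mathbf z}\big[\langle\pi_{[r]}(\mathbf y),\pi_{[r]}(\mathbf z)\rangle\big]+O\big(\tfrac1{D^2}\big), \] where $\mathbf z$ is uniform on $N_{\mathrm{per}}(\mathbf x[r])$, and \[ \overline Q_{[r]}(\mathbf y)\le 1-p+\sqrt{\tfrac{k}{2\pi}}\,e^{-c^2/2}\,\mathbb E_{\mathbf z}\big[\langle\pi_{[r]}(\mathbf y),\pi_{[r]}(\mathbf z)\rangle\big]+O\big(\tfrac1{D^2}\big), \] where $\mathbf z$ is uniform on $\overline N_{\mathrm{per}}(\mathbf x[r])$.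
   Context: Parameters: fix $C>1$; $p_C\in(0,1/2)$ is the unique solution of $C=\frac{\log p_C}{\log(1-p_C)}$; $\alpha_C:=\max\{1000,20\sqrt{C\log(10/p_C)}\}$. $D$ and $\ell_0$ are constants with $\ell_0\gg D\gg C$ ($D$ sufficiently large in terms of $C$, $\ell_0$ sufficiently large in terms of $D,C$); $\ell\ge\ell_0$ is an integer, $k=D^2\ell^2$, $p\in(p_C,1/2)$ is fixed, and $c:=c_{k,p}$. Quantities like $C\ell$ are treated as integers. $O(\cdot)$ denotes a quantity bounded in absolute value by a constant times the expression, the constant depending on $C,p$ (and $p_C,\alpha_C,c$) but not on $D$ or $\ell$. Sphere notation: $S^k$ is the unit sphere in $\mathbb R^{k+1}$ with uniform probability measure $\mathbb P$. $c_{k,p}\ge0$ is defined by $\mathbb P(\langle\mathbf x,\mathbf e\rangle\le -c_{k,p}/\sqrt k)=p$ for $\mathbf x$ uniform on $S^k$, $\mathbf e$ a fixed unit vector. For $\mathbf y\in S^k$: $N(\mathbf y)=\{\mathbf z\in S^k:\langle\mathbf y,\mathbf z\rangle\le -c/\sqrt k\}$, $\overline N(\mathbf y)=S^k\setminus N(\mathbf y)$; for $\mathbf x[r]=(\mathbf x_1,\dots,\mathbf x_r)$, $N(\mathbf x[r])=\bigcap_iN(\mathbf x_i)$, $\overline N(\mathbf x[r])=\bigcap_i\overline N(\mathbf x_i)$. $\pi_{[s]}$ is orthogonal projection of $\mathbb R^{k+1}$ onto $\mathrm{span}(\mathbf x_1,\dots,\mathbf x_s)$. A sequence $(\mathbf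 x_1,\dots,\mathbf x_m)$ in $S^k$ is perfect if $|\pi_{[i]}(\mathbf x_{i+1})|\le\alpha_C\sqrt\ell/\sqrt k$ for all $1\le i\le m-1$ (single points are perfect). For perfect $\mathbf x[r]$: $N_{\mathrm{per}}(\mathbf x[r])=\{\mathbf y\in N(\mathbf x[r]):(\mathbf x[r],\mathbf y)\text{ perfect}\}$, $\overline N_{\mathrm{per}}(\mathbf x[r])=\{\mathbf y\in\overline N(\mathbf x[r]):(\mathbf x[r],\mathbf y)\text{ perfect}\}$, $P_{\mathrm{per}}(\mathbf x[r])=\mathbb P(N_{\mathrm{per}}(\mathbf x[r]))$, $\overline P_{\mathrm{per}}(\mathbf x[r])=\mathbb P(\overline N_{\mathrm{per}}(\mathbf x[r]))$. For perfect $(\mathbf x[r],\mathbf y)$: $Q_{[r]}(\mathbf y)=P_{\mathrm{per}}(\mathbf x[r],\mathbf y)/P_{\mathrm{per}}(\mathbf x[r])$ and $\overline Q_{[r]}(\mathbf y)=\overline P_{\mathrm{per}}(\mathbf x[r],\mathbf y)/\overline P_{\mathrm{per}}(\mathbf x[r])$. *)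

theory Defs
  imports "HOL-Probability.Probability" "HOL-Library.Function_Algebras"
begin

text \<open>
  The dimension varies inside the theorem, so \<open>\<real>\<^sup>k\<^sup>+\<^sup>1\<close> is not type-indexed: as in the library's
  \<^const>\<open>Euclidean_space\<close> and \<^const>\<open>nsphere\<close>, its elements are the sequences
  \<^typ>\<open>nat \<Rightarrow> real\<close> that vanish at all indices \<open>> k\<close>, with the pointwise vector space structure.
\<close>

definition Sph :: "nat \<Rightarrow> (nat \<Rightarrow> real) set" where
  "Sph k = topspace (nsphere k)"

definition ip :: "nat \<Rightarrow> (nat \<Rightarrow> real) \<Rightarrow> (nat \<Rightarrow> real) \<Rightarrow> real" where
  "ip k x y = (\<Sum>i\<le>k. x i * y i)"

text \<open>
  The uniform probability measure on the sphere is the cone measure: the image of the uniform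
  distribution on the unit ball under radial projection. (The origin, a null set, is sent to the
  zero sequence, hence the restriction to the sphere at the end.)
\<close>

definition sphere_measure :: "nat \<Rightarrow> (nat \<Rightarrow> real) measure" where
  "sphere_measure k =
     restrict_space
       (distr
         (uniform_measure (Pi\<^sub>M {..k} (\<lambda>_. lborel))
            {x \<in> space (Pi\<^sub>M {..k} (\<lambda>_. lborel)). L2_set x {..k} \<le> 1})
         borel
         (\<lambda>x i. if i \<le> k then x i / L2_set x {..k} else 0))
       (Sph k)"

abbreviation vec_span :: "(nat \<Rightarrow> real) set \<Rightarrow> (nat \<Rightarrow> real) set" where
  "vec_span \<equiv> module.span (\<lambda>(a::real) x i. a * x i)"

definition orth_proj :: "nat \<Rightarrow> (nat \<Rightarrow> real) list \<Rightarrow> (nat \<Rightarrow> real) \<Rightarrow> (nat \<Rightarrow> real)" where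
  "orth_proj k xs v =
     (THE u. u \<in> vec_span (set xs) \<and> (\<forall>w\<in>vec_span (set xs). ip k (v - u) w = 0))"

definition p_C :: "real \<Rightarrow> real" where
  "p_C C = (THE q. 0 < q \<and> q < 1/2 \<and> C = ln q / ln (1 - q))"

definition alpha_C :: "real \<Rightarrow> real" where
  "alpha_C C = max 1000 (20 * sqrt (C * ln (10 / p_C C)))"

text \<open>The fixed unit vector in the definition of \<open>c\<^bsub>k,p\<^esub>\<close> is taken to be the first basis vector.\<close>

definition c_const :: "nat \<Rightarrow> real \<Rightarrow> real" where
  "c_const k p = (THE c. 0 \<le> c \<and>
     measure (sphere_measure k)
       {x \<in> Sph k. ip k x (\<lambda>i. if i = 0 then 1 else 0) \<le> - c / sqrt k} = p)"

definition nbhd :: "nat \<Rightarrow> real \<Rightarrow> (nat \<Rightarrow> real) \<Rightarrow> (nat \<Rightarrow> real) set" where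
  "nbhd k p y = {z \<in> Sph k. ip k y z \<le> - c_const k p / sqrt k}"

definition co_nbhd :: "nat \<Rightarrow> real \<Rightarrow> (nat \<Rightarrow> real) \<Rightarrow> (nat \<Rightarrow> real) set" where
  "co_nbhd k p y = Sph k - nbhd k p y"

text \<open>Lists are indexed from \<open>0\<close>: \<open>xs ! i\<close> is \<open>\<^bold>x\<^bsub>i+1\<^esub>\<close> and \<open>take i xs\<close> is \<open>\<^bold>x[i]\<close>.\<close>

definition perfect :: "real \<Rightarrow> nat \<Rightarrow> nat \<Rightarrow> (nat \<Rightarrow> real) list \<Rightarrow> bool" where
  "perfect C l k xs \<longleftrightarrow> xs \<noteq> [] \<and> set xs \<subseteq> Sph k \<and>
     (\<forall>i. 1 \<le> i \<and> i < length xs \<longrightarrow>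
        L2_set (orth_proj k (take i xs) (xs ! i)) {..k} \<le> alpha_C C * sqrt l / sqrt k)"

definition N_per :: "real \<Rightarrow> nat \<Rightarrow> nat \<Rightarrow> real \<Rightarrow> (nat \<Rightarrow> real) list \<Rightarrow> (nat \<Rightarrow> real) set" where
  "N_per C l k p xs = {y \<in> (\<Inter>x\<in>set xs. nbhd k p x). perfect C l k (xs @ [y])}"

definition co_N_per :: "real \<Rightarrow> nat \<Rightarrow> nat \<Rightarrow> real \<Rightarrow> (nat \<Rightarrow> real) list \<Rightarrow> (nat \<Rightarrow> real) set" where
  "co_N_per C l k p xs = {y \<in> (\<Inter>x\<in>set xs. co_nbhd k p x). perfect C l k (xs @ [y])}"

definition P_per :: "real \<Rightarrow> nat \<Rightarrow> nat \<Rightarrow> real \<Rightarrow> (nat \<Rightarrow> real) list \<Rightarrow> real" where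
  "P_per C l k p xs = measure (sphere_measure k) (N_per C l k p xs)"

definition co_P_per :: "real \<Rightarrow> nat \<Rightarrow> nat \<Rightarrow> real \<Rightarrow> (nat \<Rightarrow> real) list \<Rightarrow> real" where
  "co_P_per C l k p xs = measure (sphere_measure k) (co_N_per C l k p xs)"

definition Q_ratio :: "real \<Rightarrow> nat \<Rightarrow> nat \<Rightarrow> real \<Rightarrow> (nat \<Rightarrow> real) list \<Rightarrow> (nat \<Rightarrow> real) \<Rightarrow> real" where
  "Q_ratio C l k p xs y = P_per C l k p (xs @ [y]) / P_per C l k p xs"

definition co_Q_ratio :: "real \<Rightarrow> nat \<Rightarrow> nat \<Rightarrow> real \<Rightarrow> (nat \<Rightarrow> real) list \<Rightarrow> (nat \<Rightarrow> real) \<Rightarrow> real" where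
  "co_Q_ratio C l k p xs y = co_P_per C l k p (xs @ [y]) / co_P_per C l k p xs"

text \<open>The expectation of \<open>\<langle>\<pi>\<^bsub>[r]\<^esub>(\<^bold>y), \<pi>\<^bsub>[r]\<^esub>(\<^bold>z)\<rangle>\<close> for \<open>\<^bold>z\<close> uniform on \<open>A\<close>.\<close>

definition E_proj :: "nat \<Rightarrow> (nat \<Rightarrow> real) set \<Rightarrow> (nat \<Rightarrow> real) list \<Rightarrow> (nat \<Rightarrow> real) \<Rightarrow> real" where
  "E_proj k A xs y =
     (LINT z | uniform_measure (sphere_measure k) A. ip k (orth_proj k xs y) (orth_proj k xs z))"

end

theory Submission
  imports Defs
begin

text \<open>
  Let \<open>B\<close> be an orthonormal basis of the span of \<open>\<^bold>x[r]\<close>, so that \<open>\<pi>\<^bsub>[r]\<^esub>\<close> is the projection onto \<open>B\<close>.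
  The set \<open>N\<^sub>p\<^sub>e\<^sub>r(\<^bold>x[r])\<close> only depends on \<open>\<pi>\<^bsub>[r]\<^esub>(\<^bold>z)\<close>, so it is invariant under the reflections fixing \<open>B\<close>,
  and the component of \<open>\<^bold>y\<close> orthogonal to \<open>B\<close> may be replaced by a random direction: the orthogonal
  component \<open>h'\<close> of a standard Gaussian vector \<open>h\<close>. Exchanging the two integrals, one has to find, for
  fixed \<open>\<^bold>z\<close>, the Gaussian probability of \<open>\<langle>h', \<^bold>z\<rangle> \<le> \<theta>(\<^bold>z) |h'|\<close>. Here \<open>\<langle>h', \<^bold>z\<rangle>\<close> is a normal variable and
  \<open>|h'|\<close> is concentrated near \<open>\<surd>k\<close>, so the probability is close to \<open>\<Phi>(-c - t)\<close> with
  \<open>t = \<surd>k \<langle>\<pi>\<^bsub>[r]\<^esub>(\<^bold>y), \<pi>\<^bsub>[r]\<^esub>(\<^bold>z)\<rangle> = O(1/D)\<close>; likewise \<open>p\<close> is close to \<open>\<Phi>(-c)\<close>. A second order expansion of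
  the normal distribution function \<open>\<Phi>\<close> at \<open>-c\<close> gives the result.
\<close>

section \<open>Inner products, orthonormal spanning sets and reflections\<close>

text \<open>The error \<open>1/D^2\<close> is dictated by one term. Perfectness bounds both
  projections by r = \<alpha> sqrt(l/k), so |t| <= sqrt k r^2 = \<alpha>^2 l / sqrt k =
  \<alpha>^2/D, and the quadratic remainder t^2 costs \<alpha>^4/D^2. All other errors (fluctuation
  of |h'|, lengths of the components of y and z orthogonal to B, p against \<Phi>(-c)) tend to 0 as
  l grows with D fixed, provided c stays bounded uniformly in k; that bound comes from p > p_C.
  Gaussian vectors combine two properties: independent coordinates give concentration of |h| by
  Chebyshev, and rotational symmetry gives the law of every <h, u>. Reflections alone supply the
  symmetry: two unit vectors orthogonal to B are exchanged by a reflection fixing B, and an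
  isometric involution is easy to handle under the integral. The bounds are one-sided because
  appending y enlarges the span onto which z is projected: perfectness of z after y is stronger than
  before, so the numerator of the ratio is only included in a cap of the old region. The measure of
  that cap is estimated from both sides, which serves both inequalities through complements.\<close>

interpretation fun_vec: vector_space "\<lambda>(a::real) (x :: nat \<Rightarrow> real) i. a * x i"
  by unfold_locales (auto simp: fun_eq_iff algebra_simps)

lemma ip_commute: "ip k x y = ip k y x"
  by (simp add: ip_def mult.commute)

lemma ip_linear:
  "ip k (\<lambda>i. x i + y i) z = ip k x z + ip k y z"
  "ip k (\<lambda>i. x i - y i) z = ip k x z - ip k y z"
  "ip k (\<lambda>i. a * x i) z = a * ip k x z"
  "ip k z (\<lambda>i. x i + y i) = ip k z x + ip k z y"
  "ip k z (\<lambda>i. x i - y i) = ip k z x - ip k z y"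
  "ip k z (\<lambda>i. a * x i) = a * ip k z x"
  by (simp_all add: ip_def algebra_simps sum.distrib sum_subtractf sum_distrib_left)

lemma ip_fun_linear:
  "ip k (x + y) z = ip k x z + ip k y z" "ip k (x - y) z = ip k x z - ip k y z"
  "ip k z (x + y) = ip k z x + ip k z y" "ip k z (x - y) = ip k z x - ip k z y"
  "ip k 0 z = 0" "ip k z 0 = 0"
  by (simp_all add: ip_def algebra_simps sum.distrib sum_subtractf)

lemma ip_sum_left: "ip k (\<lambda>i. \<Sum>b\<in>B. f b * g b i) z = (\<Sum>b\<in>B. f b * ip k (g b) z)"
  unfolding ip_def sum_distrib_left sum_distrib_right
  by (subst sum.swap) (simp add: mult.assoc)

lemma ip_self_nonneg [simp]: "0 \<le> ip k x x"
  by (simp add: ip_def sum_nonneg)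

lemma L2_set_ip: "L2_set x {..k} = sqrt (ip k x x)"
  by (simp add: L2_set_def ip_def power2_eq_square)

lemma ip_self_eq_0_iff: "ip k x x = 0 \<longleftrightarrow> (\<forall>i\<le>k. x i = 0)"
  by (auto simp: ip_def sum_nonneg_eq_0_iff)

lemma ip_Cauchy_Schwarz: "\<bar>ip k x y\<bar> \<le> sqrt (ip k x x) * sqrt (ip k y y)"
proof -
  have "\<bar>ip k x y\<bar> \<le> (\<Sum>i\<le>k. \<bar>x i\<bar> * \<bar>y i\<bar>)"
    unfolding ip_def by (rule order_trans[OF sum_abs]) (simp add: abs_mult)
  also have "\<dots> \<le> L2_set x {..k} * L2_set y {..k}" by (rule L2_set_mult_ineq)
  finally show ?thesis by (simp add: L2_set_ip)
qed

lemma ip_cong: "(\<And>i. i \<le> k \<Longrightarrow> x i = x' i) \<Longrightarrow> (\<And>i. i \<le> k \<Longrightarrow> y i = y' i) \<Longrightarrow> ip k x y = ip k x' y'"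
  by (simp add: ip_def)

lemma Sph_iff: "x \<in> Sph k \<longleftrightarrow> ip k x x = 1 \<and> (\<forall>i>k. x i = 0)"
  by (simp add: Sph_def nsphere ip_def power2_eq_square)

definition orthonormal :: "nat \<Rightarrow> (nat \<Rightarrow> real) set \<Rightarrow> bool" where
  "orthonormal k B \<longleftrightarrow> finite B \<and> (\<forall>b\<in>B. \<forall>i>k. b i = 0) \<and>
     (\<forall>b\<in>B. \<forall>b'\<in>B. ip k b b' = (if b = b' then 1 else 0))"

definition proj :: "nat \<Rightarrow> (nat \<Rightarrow> real) set \<Rightarrow> (nat \<Rightarrow> real) \<Rightarrow> nat \<Rightarrow> real" where
  "proj k B v = (\<lambda>i. \<Sum>b\<in>B. ip k v b * b i)"

lemma ip_proj_basis: "orthonormal k B \<Longrightarrow> b \<in> B \<Longrightarrow> ip k (proj k B v) b = ip k v b"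
proof -
  assume B: "orthonormal k B" "b \<in> B"
  have "ip k (proj k B v) b = (\<Sum>b'\<in>B. if b' = b then ip k v b' else 0)"
    unfolding proj_def ip_sum_left using B by (intro sum.cong) (auto simp: orthonormal_def)
  with B show ?thesis by (simp add: orthonormal_def)
qed

lemma ip_proj_left: "ip k (proj k B v) w = (\<Sum>b\<in>B. ip k v b * ip k w b)"
  by (simp add: proj_def ip_sum_left ip_commute[of k w])

lemma ip_proj_proj:
  assumes "orthonormal k B"
  shows "ip k (proj k B v) (proj k B w) = (\<Sum>b\<in>B. ip k v b * ip k w b)"
proof -
  have "ip k (proj k B v) (proj k B w) = (\<Sum>b\<in>B. ip k v b * ip k (proj k B w) b)"
    by (rule ip_proj_left)
  then show ?thesis using ip_proj_basis[OF assms] by simp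
qed

text \<open>\<open>ip k\<close> sees only the coordinates up to k. Vanishing beyond k is what turns
  \<open>ip k u u = 0\<close> into equality of functions.\<close>

lemma span_vanish:
  assumes "\<And>x. x \<in> S \<Longrightarrow> \<forall>i>k. x i = 0" "u \<in> vec_span S"
  shows "\<forall>i>k. u i = 0"
  using assms(2)
  by (induction rule: fun_vec.span_induct_alt) (auto dest: assms(1))

lemma ip_span_eq_0:
  assumes "\<And>x. x \<in> S \<Longrightarrow> ip k v x = 0" "u \<in> vec_span S"
  shows "ip k v u = 0"
  using assms(2)
  by (induction rule: fun_vec.span_induct_alt) (auto simp: assms(1) ip_fun_linear ip_linear simp flip: zero_fun_def)

lemma proj_in_span: "proj k B v \<in> vec_span B"
proof -
  have "(\<lambda>i. \<Sum>b\<in>B. ip k v b * b i) = (\<Sum>b\<in>B. (\<lambda>i. ip k v b * b i))"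
    by (induction B rule: infinite_finite_induct) (auto simp: fun_eq_iff)
  also have "\<dots> \<in> vec_span B"
    by (intro fun_vec.span_sum fun_vec.span_scale fun_vec.span_base)
  finally show ?thesis by (simp add: proj_def)
qed

lemma proj_orth:
  assumes "orthonormal k B" "w \<in> vec_span B"
  shows "ip k (v - proj k B v) w = 0"
  by (rule ip_span_eq_0[OF _ assms(2)]) (simp add: ip_fun_linear ip_proj_basis[OF assms(1)])

text \<open>Gram-Schmidt along the list. The vectors may be dependent; a vanishing residue
  \<open>x'\<close> leaves B unchanged, so the cardinality is only bounded by the length.\<close>

lemma orthonormal_spanning:
  assumes "\<And>x. x \<in> set xs \<Longrightarrow> \<forall>i>k. x i = 0"
  shows "\<exists>B. orthonormal k B \<and> card B \<le> length xs \<and> vec_span B = vec_span (set xs)"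
  using assms
proof (induction xs)
  case Nil
  then show ?case by (intro exI[of _ "{}"]) (simp add: orthonormal_def)
next
  case (Cons x xs)
  then obtain B where B: "orthonormal k B" "card B \<le> length xs" "vec_span B = vec_span (set xs)"
    by auto
  define x' where "x' = x - proj k B x"
  have Bv: "\<forall>i>k. u i = 0" if "u \<in> vec_span B" for u
    using span_vanish[OF _ that] B(1) unfolding orthonormal_def by blast
  have orth: "ip k x' b = 0" if "b \<in> B" for b
    unfolding x'_def using proj_orth[OF B(1) fun_vec.span_base[OF that]] .
  have x'v: "\<forall>i>k. x' i = 0"
    using Cons.prems[of x] Bv[OF proj_in_span[of k B x]] by (simp add: x'_def)
  have span_eq: "vec_span (insert x' B) = vec_span (set (x # xs))"
  proof -
    have "vec_span (insert x' B) = vec_span (insert x B)"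
    proof (rule fun_vec.span_eq[THEN iffD2], safe)
      show "x' \<in> vec_span (insert x B)" unfolding x'_def
        by (rule fun_vec.span_diff, rule fun_vec.span_base, simp)
           (use proj_in_span fun_vec.span_mono[of B "insert x B"] in blast)
      have "x = x' + proj k B x" by (simp add: x'_def)
      also have "\<dots> \<in> vec_span (insert x' B)"
        by (rule fun_vec.span_add, rule fun_vec.span_base, simp)
           (use proj_in_span fun_vec.span_mono[of B "insert x' B"] in blast)
      finally show "x \<in> vec_span (insert x' B)" .
    qed (auto intro: fun_vec.span_base)
    also have "\<dots> = vec_span (set (x # xs))"
      unfolding list.set using B(3) by (simp add: fun_vec.span_insert)
    finally show ?thesis .
  qed
  show ?case
  proof (cases "ip k x' x' = 0")
    case True
    then have "x' = 0" using x'v by (metis ext ip_self_eq_0_iff not_le zero_fun_apply)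
    then have "vec_span B = vec_span (set (x # xs))" using span_eq by (simp add: fun_vec.span_insert_0)
    then show ?thesis using B by auto
  next
    case False
    define n where "n = sqrt (ip k x' x')"
    have n: "n > 0" "n * n = ip k x' x'" using False by (auto simp: n_def less_le)
    define u where "u = (\<lambda>i. inverse n * x' i)"
    have ub: "ip k u b = 0" "ip k b u = 0" if "b \<in> B" for b
      using orth[OF that] by (auto simp: u_def ip_linear ip_commute[of k b])
    have uu: "ip k u u = 1" using n unfolding u_def ip_linear n(2)[symmetric] by (simp add: field_simps)
    have "u \<notin> B" using ub uu by force
    have "orthonormal k (insert u B)"
      using B(1) ub uu x'v \<open>u \<notin> B\<close> unfolding orthonormal_def by (auto simp: u_def)
    moreover have "card (insert u B) \<le> length (x # xs)"
      using B(2) \<open>u \<notin> B\<close> B(1) by (simp add: orthonormal_def)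
    moreover have "vec_span (insert u B) = vec_span (insert x' B)"
    proof (rule fun_vec.span_eq[THEN iffD2], safe)
      show "u \<in> vec_span (insert x' B)" unfolding u_def
        by (intro fun_vec.span_scale fun_vec.span_base) simp
      have "x' = (\<lambda>i. n * u i)" using n by (auto simp: u_def)
      also have "\<dots> \<in> vec_span (insert u B)"
        by (intro fun_vec.span_scale fun_vec.span_base) simp
      finally show "x' \<in> vec_span (insert u B)" .
    qed (auto intro: fun_vec.span_base)
    ultimately show ?thesis using span_eq by metis
  qed
qed

text \<open>The difference of two candidates lies in the span and is orthogonal to it, hence to
  itself. This resolves the definite description in \<open>orth_proj\<close>.\<close>

lemma orth_proj_unique:
  assumes "\<And>x. x \<in> set xs \<Longrightarrow> \<forall>i>k. x i = 0"
    and "u \<in> vec_span (set xs)" "\<And>w. w \<in> vec_span (set xs) \<Longrightarrow> ip k (v - u) w = 0"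
  shows "orth_proj k xs v = u"
  unfolding orth_proj_def
proof (rule the_equality)
  fix u' assume u': "u' \<in> vec_span (set xs) \<and> (\<forall>w\<in>vec_span (set xs). ip k (v - u') w = 0)"
  then have d: "u' - u \<in> vec_span (set xs)" using assms(2) by (simp add: fun_vec.span_diff)
  have "ip k (u' - u) (u' - u) = ip k (v - u) (u' - u) - ip k (v - u') (u' - u)"
    by (simp add: ip_fun_linear)
  also have "\<dots> = 0" using assms(3)[OF d] u' d by simp
  finally have "\<forall>i\<le>k. (u' - u) i = 0" by (simp add: ip_self_eq_0_iff)
  with span_vanish[OF assms(1) d] show "u' = u"
    by (metis (no_types, opaque_lifting) eq_iff_diff_eq_0 ext not_le zero_fun_apply)
qed (use assms in auto)

lemma orth_proj_eq_proj:
  assumes "\<And>x. x \<in> set xs \<Longrightarrow> \<forall>i>k. x i = 0" "orthonormal k B" "vec_span B = vec_span (set xs)"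
  shows "orth_proj k xs v = proj k B v"
  using assms(3)
  by (intro orth_proj_unique[OF assms(1)]) (auto simp: proj_in_span simp flip: assms(3) intro: proj_orth[OF assms(2)])

text \<open>The projection u onto the smaller span may be tested against both residues, so <u,u> =
  <u',u>, and Cauchy-Schwarz gives |u| <= |u'|. It is the reason why perfectness survives the
  removal of an earlier vector.\<close>

lemma norm_orth_proj_mono:
  assumes "\<And>x. x \<in> set ys \<Longrightarrow> \<forall>i>k. x i = 0" "set xs \<subseteq> set ys"
  shows "L2_set (orth_proj k xs v) {..k} \<le> L2_set (orth_proj k ys v) {..k}"
proof -
  have x: "\<And>x. x \<in> set xs \<Longrightarrow> \<forall>i>k. x i = 0" using assms by blast
  obtain B where B: "orthonormal k B" "vec_span B = vec_span (set xs)"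
    using orthonormal_spanning[of xs k] x by blast
  obtain B' where B': "orthonormal k B'" "vec_span B' = vec_span (set ys)"
    using orthonormal_spanning[of ys k] assms by blast
  define u where "u = proj k B v"
  define u' where "u' = proj k B' v"
  have "u \<in> vec_span B" unfolding u_def by (rule proj_in_span)
  moreover from this have "u \<in> vec_span B'"
    using B(2) B'(2) fun_vec.span_mono[OF assms(2)] by auto
  ultimately have "ip k (v - u) u = 0" "ip k (v - u') u = 0"
    unfolding u_def u'_def by (auto intro: proj_orth B(1) B'(1))
  then have "ip k u u = ip k u' u" by (simp add: ip_fun_linear)
  also have "\<dots> \<le> sqrt (ip k u' u') * sqrt (ip k u u)"
    using ip_Cauchy_Schwarz[of k u' u] by linarith
  finally have "sqrt (ip k u u) * sqrt (ip k u u) \<le> sqrt (ip k u' u') * sqrt (ip k u u)" by simp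
  then have "sqrt (ip k u u) \<le> sqrt (ip k u' u')"
    by (cases "ip k u u = 0") (simp_all add: mult_le_cancel_right less_le del: real_sqrt_le_iff real_sqrt_mult_self)
  then show ?thesis
    using orth_proj_eq_proj[OF x B, of v] orth_proj_eq_proj[OF assms(1) B', of v]
    by (simp add: L2_set_ip u_def u'_def)
qed

text \<open>The Householder reflection in the hyperplane orthogonal to w. If w has norm 0, division
  by zero makes it the identity, so the algebraic laws below hold for every w.\<close>

definition reflect :: "nat \<Rightarrow> (nat \<Rightarrow> real) \<Rightarrow> (nat \<Rightarrow> real) \<Rightarrow> nat \<Rightarrow> real" where
  "reflect k w x = (\<lambda>i. x i - 2 * ip k x w / ip k w w * w i)"

lemma ip_reflect_left: "ip k (reflect k w x) y = ip k x y - 2 * ip k x w / ip k w w * ip k w y"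
  by (simp add: reflect_def ip_linear del: times_divide_eq_left)

lemma ip_reflect_right: "ip k x (reflect k w y) = ip k x y - 2 * ip k y w / ip k w w * ip k x w"
  by (simp add: reflect_def ip_linear del: times_divide_eq_left)

lemma ip_reflect_reflect: "ip k (reflect k w x) (reflect k w y) = ip k x y"
  by (cases "ip k w w = 0")
    (simp_all add: ip_reflect_left[of k w x] ip_reflect_right ip_commute[of k w y] field_simps)

lemma ip_reflect_self_adjoint: "ip k (reflect k w x) y = ip k x (reflect k w y)"
  by (simp add: ip_reflect_left ip_reflect_right ip_commute[of k w y])

lemma reflect_reflect: "reflect k w (reflect k w x) = x"
proof -
  have *: "ip k (reflect k w x) w / ip k w w = - (ip k x w / ip k w w)"
    by (cases "ip k w w = 0") (simp_all add: ip_reflect_left)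
  have "reflect k w (reflect k w x) i = reflect k w x i + 2 * (ip k x w / ip k w w) * w i" for i
    unfolding reflect_def[of k w "reflect k w x"] times_divide_eq_right[symmetric] * by simp
  then show ?thesis by (simp add: reflect_def fun_eq_iff)
qed

text \<open>For equal norms |x - y|^2 = 2 <x, x - y>, so the reflection subtracts exactly x - y from
  x. The claim is limited to coordinates up to k because in the degenerate case x and y are known to
  agree only there.\<close>

lemma reflect_swap:
  assumes "ip k x x = ip k y y" and "i \<le> k"
  shows "reflect k (x - y) x i = y i"
proof (cases "ip k (x - y) (x - y) = 0")
  case True
  then show ?thesis using assms(2) by (auto simp: reflect_def ip_self_eq_0_iff)
next
  case False
  have "ip k (x - y) (x - y) = 2 * ip k x (x - y)"
    using assms(1) by (simp add: ip_fun_linear ip_commute[of k y x])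
  with False show ?thesis by (simp add: reflect_def)
qed

section \<open>The Gaussian measure and its invariance under reflections\<close>

abbreviation leb :: "nat \<Rightarrow> (nat \<Rightarrow> real) measure" where
  "leb k \<equiv> PiM {..k} (\<lambda>_. lborel)"

definition gauss :: "nat \<Rightarrow> (nat \<Rightarrow> real) measure" where
  "gauss k = PiM {..k} (\<lambda>_. std_normal_distribution)"

definition gauss_density :: "nat \<Rightarrow> (nat \<Rightarrow> real) \<Rightarrow> real" where
  "gauss_density k x = (1 / sqrt (2 * pi)) ^ (k + 1) * exp (- ip k x x / 2)"

interpretation lborel_prod: product_sigma_finite "\<lambda>_::nat. lborel :: real measure"
  by (simp add: product_sigma_finite_def lborel.sigma_finite_measure_axioms)

interpretation std_normal: real_distribution std_normal_distribution
  by (rule real_dist_normal_dist)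

interpretation normal_prod: product_sigma_finite "\<lambda>_::nat. std_normal_distribution"
  by unfold_locales

interpretation gauss: prob_space "gauss k" for k
  unfolding gauss_def by (rule prob_space_PiM) (rule std_normal.prob_space_axioms)

interpretation leb: sigma_finite_measure "leb k" for k
  by (rule lborel_prod.sigma_finite) simp

interpretation leb_pair: pair_sigma_finite "leb k" "leb k" for k
  by unfold_locales

lemma sets_gauss [measurable_cong]: "sets (gauss k) = sets (leb k)"
  unfolding gauss_def by (intro sets_PiM_cong) auto

lemma space_gauss: "space (gauss k) = space (leb k)"
  using sets_gauss by (rule sets_eq_imp_space_eq)

lemma measurable_ip [measurable]:
  assumes "\<And>i. i \<le> k \<Longrightarrow> (\<lambda>x. f x i) \<in> borel_measurable M" "\<And>i. i \<le> k \<Longrightarrow> (\<lambda>x. g x i) \<in> borel_measurable M"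
  shows "(\<lambda>x. ip k (f x) (g x)) \<in> borel_measurable M"
  unfolding ip_def using assms by (intro borel_measurable_sum borel_measurable_times) auto

lemma measurable_leb_component [measurable]: "i \<le> k \<Longrightarrow> (\<lambda>x. x i) \<in> borel_measurable (leb k)"
  by (rule measurable_component_singleton[where M="\<lambda>_. lborel", simplified]) simp

lemma measurable_gauss_component [measurable]: "i \<le> k \<Longrightarrow> (\<lambda>x. x i) \<in> borel_measurable (gauss k)"
  by (simp add: measurable_leb_component measurable_cong_sets[OF sets_gauss refl])

lemma measurable_into_leb:
  assumes "\<And>i. i \<le> k \<Longrightarrow> (\<lambda>x. f x i) \<in> borel_measurable M"
  shows "(\<lambda>x. restrict (f x) {..k}) \<in> measurable M (leb k)"
  using assms by (intro measurable_restrict) auto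

lemma ip_restrict [simp]:
  "ip k (restrict f {..k}) g = ip k f g" "ip k f (restrict g {..k}) = ip k f g"
  by (auto intro: ip_cong)

lemma reflect_cong: "(\<And>i. i \<le> k \<Longrightarrow> x i = x' i) \<Longrightarrow> i \<le> k \<Longrightarrow> reflect k w x i = reflect k w x' i"
  unfolding reflect_def by (simp cong: ip_cong)

lemma reflect_add: "reflect k w (\<lambda>i. x i + y i) = (\<lambda>i. reflect k w x i + reflect k w y i)"
  by (simp add: reflect_def ip_linear algebra_simps add_divide_distrib fun_eq_iff)

lemma reflect_diff: "reflect k w (\<lambda>i. x i - y i) = (\<lambda>i. reflect k w x i - reflect k w y i)"
  by (simp add: reflect_def ip_linear algebra_simps diff_divide_distrib fun_eq_iff)

lemma reflect_swap':
  assumes "ip k x x = ip k y y" and "i \<le> k"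
  shows "reflect k (x - y) y i = x i"
proof -
  have "reflect k (x - y) y i = reflect k (x - y) (reflect k (x - y) x) i"
    using assms by (intro reflect_cong) (simp_all add: reflect_swap)
  then show ?thesis by (simp add: reflect_reflect)
qed

text \<open>A product measure is determined by its values on boxes, and a translated box is a box
  whose sides have the same lengths.\<close>

lemma distr_translate_leb:
  "distr (leb k) (leb k) (\<lambda>x. \<lambda>i\<in>{..k}. a i + x i) = leb k"
proof (rule lborel_prod.PiM_eqI)
  fix A assume A: "\<And>i. i \<in> {..k} \<Longrightarrow> A i \<in> sets (lborel :: real measure)"
  have m: "(\<lambda>x. \<lambda>i\<in>{..k}. a i + x i) \<in> measurable (leb k) (leb k)"
    by (rule measurable_into_leb) measurable
  have 1: "(\<lambda>x. \<lambda>i\<in>{..k}. a i + x i) -` (PiE {..k} A) \<inter> space (leb k)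
      = PiE {..k} (\<lambda>i. (+) (a i) -` A i)"
    by (auto simp: space_PiM PiE_iff)
  have 2: "emeasure lborel ((+) (a i) -` A i) = emeasure lborel (A i)" if "i \<le> k" for i
  proof -
    have "emeasure lborel (A i) = emeasure (distr lborel borel ((+) (a i))) (A i)"
      by (simp add: lborel_distr_plus)
    also have "\<dots> = emeasure lborel ((+) (a i) -` A i)"
      using A[of i] that by (subst emeasure_distr) auto
    finally show ?thesis ..
  qed
  have "(+) (a i) -` A i \<in> sets lborel" if "i \<le> k" for i
    using measurable_sets[of "(+) (a i)" lborel borel "A i"] A[of i] that by simp
  then show "emeasure (distr (leb k) (leb k) (\<lambda>x. \<lambda>i\<in>{..k}. a i + x i)) (PiE {..k} A)
      = (\<Prod>i\<le>k. emeasure lborel (A i))"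
    using A 2
    by (subst emeasure_distr[OF m])
      (auto simp: 1 intro!: sets_PiM_I_finite lborel_prod.emeasure_PiM[THEN trans] prod.cong)
qed auto

lemma nn_integral_translate_leb:
  assumes "f \<in> borel_measurable (leb k)"
  shows "(\<integral>\<^sup>+x. f (\<lambda>i\<in>{..k}. a i + x i) \<partial>leb k) = (\<integral>\<^sup>+x. f x \<partial>leb k)"
proof -
  have "(\<integral>\<^sup>+x. f x \<partial>leb k) = (\<integral>\<^sup>+x. f x \<partial>distr (leb k) (leb k) (\<lambda>x. \<lambda>i\<in>{..k}. a i + x i))"
    by (simp add: distr_translate_leb)
  also have "\<dots> = (\<integral>\<^sup>+x. f (\<lambda>i\<in>{..k}. a i + x i) \<partial>leb k)"
    by (rule nn_integral_distr) (auto intro!: measurable_into_leb assms borel_measurable_add)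
  finally show ?thesis ..
qed

section \<open>The Gaussian measure as a density that depends only on the norm\<close>

lemma gauss_density_prod: "ennreal (gauss_density k x) = (\<Prod>i\<le>k. ennreal (std_normal_density (x i)))"
proof -
  have "gauss_density k x = (\<Prod>i\<le>k. std_normal_density (x i))"
    by (simp add: gauss_density_def std_normal_density_def prod.distrib ip_def power2_eq_square
        sum_divide_distrib exp_sum prod_dividef power_divide flip: sum_negf)
  then show ?thesis by (simp add: prod_ennreal)
qed

lemma measurable_gauss_density [measurable]:
  assumes "\<And>i. i \<le> k \<Longrightarrow> (\<lambda>x. f x i) \<in> borel_measurable M"
  shows "(\<lambda>x. gauss_density k (f x)) \<in> borel_measurable M"
  unfolding gauss_density_def using assms by measurable

lemma gauss_eq_density: "gauss k = density (leb k) (gauss_density k)"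
  unfolding gauss_def
proof (rule normal_prod.PiM_eqI[symmetric])
  fix A assume "\<And>i. i \<in> {..k} \<Longrightarrow> A i \<in> sets (std_normal_distribution)"
  then have A: "A i \<in> sets borel" if "i \<le> k" for i using that by simp
  have "emeasure (density (leb k) (gauss_density k)) (PiE {..k} A)
      = (\<integral>\<^sup>+x. ennreal (gauss_density k x) * indicator (PiE {..k} A) x \<partial>leb k)"
    using A by (subst emeasure_density) (auto intro!: sets_PiM_I_finite)
  also have "\<dots> = (\<integral>\<^sup>+x. (\<Prod>i\<le>k. ennreal (std_normal_density (x i)) * indicator (A i) (x i)) \<partial>leb k)"
  proof (rule nn_integral_cong)
    fix x assume "x \<in> space (leb k)"
    then have "indicator (PiE {..k} A) x = (\<Prod>i\<le>k. indicator (A i) (x i) :: ennreal)"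
      by (auto simp: indicator_def prod_zero_iff space_PiM PiE_iff)
    then show "ennreal (gauss_density k x) * indicator (PiE {..k} A) x
        = (\<Prod>i\<le>k. ennreal (std_normal_density (x i)) * indicator (A i) (x i))"
      by (simp add: gauss_density_prod prod.distrib)
  qed
  also have "\<dots> = (\<Prod>i\<le>k. \<integral>\<^sup>+x. ennreal (std_normal_density x) * indicator (A i) x \<partial>lborel)"
    using A by (intro lborel_prod.product_nn_integral_prod) auto
  also have "\<dots> = (\<Prod>i\<le>k. emeasure (std_normal_distribution) (A i))"
    using A by (intro prod.cong) (auto simp: emeasure_density)
  finally show "emeasure (density (leb k) (gauss_density k)) (PiE {..k} A) = \<dots>" .
qed (auto intro!: sets_PiM_cong)

lemma nn_integral_gauss_density: "(\<integral>\<^sup>+x. ennreal (gauss_density k x) \<partial>leb k) = 1"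
proof -
  have "1 = emeasure (gauss k) (space (gauss k))" by (simp add: gauss.emeasure_space_1)
  also have "\<dots> = (\<integral>\<^sup>+x. ennreal (gauss_density k x) \<partial>leb k)"
    unfolding gauss_eq_density by (subst emeasure_density) (auto intro!: nn_integral_cong)
  finally show ?thesis ..
qed

text \<open>Points of \<open>leb k\<close> are undefined beyond k, whereas \<open>reflect\<close>
  yields arbitrary values there; the restriction returns to the product space.\<close>

definition refl_leb :: "nat \<Rightarrow> (nat \<Rightarrow> real) \<Rightarrow> (nat \<Rightarrow> real) \<Rightarrow> nat \<Rightarrow> real" where
  "refl_leb k w x = restrict (reflect k w x) {..k}"

lemma measurable_refl_leb [measurable]: "refl_leb k w \<in> measurable (leb k) (leb k)"
  unfolding refl_leb_def reflect_def by (rule measurable_into_leb) measurable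

text \<open>
  This is the uniqueness argument for Haar measure: integrate the indicator of a set against a
  weight that the reflection preserves, and use translation invariance on both factors.
\<close>

lemma distr_refl_leb: "distr (leb k) (leb k) (refl_leb k w) = leb k"
proof (rule measure_eqI)
  fix A assume "A \<in> sets (distr (leb k) (leb k) (refl_leb k w))"
  then have A [measurable]: "A \<in> sets (leb k)" by simp
  define T where "T = refl_leb k w"
  have T [measurable]: "T \<in> measurable (leb k) (leb k)" unfolding T_def by measurable
  have Ti: "(\<lambda>x. T x i) \<in> borel_measurable (leb k)" if "i \<le> k" for i
    using measurable_compose[OF T measurable_leb_component[OF that]] .
  define G where "G = (\<lambda>x. ennreal (gauss_density k x))"
  have G_cong: "G x = G y" if "ip k x x = ip k y y" for x y
    using that by (simp add: G_def gauss_density_def)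
  have Gm [measurable]: "G \<in> borel_measurable (leb k)" unfolding G_def by measurable
  define plus where "plus x y = (\<lambda>i\<in>{..k}. (x i :: real) + y i)" for x y
  have plus_m: "(\<lambda>p. plus (f p) (g p)) \<in> measurable N (leb k)"
    if "f \<in> measurable N (leb k)" "g \<in> measurable N (leb k)" for f g and N :: "'z measure"
    unfolding plus_def
    by (intro measurable_into_leb borel_measurable_add measurable_compose[OF that(1)]
        measurable_compose[OF that(2)] measurable_leb_component)
  \<comment> \<open>Linearity and involutivity: T (T y + x) = y + T x. That y is in the space
    matters, since T (T y) is always restricted.\<close>
  have T_plus: "T (plus (T y) x) = plus (T x) y" if "y \<in> space (leb k)" for x y
  proof -
    have "reflect k w (plus (T y) x) i = reflect k w (reflect k w y) i + reflect k w x i" if "i \<le> k" for i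
    proof -
      have "reflect k w (plus (T y) x) i = reflect k w (\<lambda>i. reflect k w y i + x i) i"
        using that by (intro reflect_cong) (simp_all add: plus_def T_def refl_leb_def)
      then show ?thesis by (simp add: reflect_add reflect_reflect)
    qed
    then show ?thesis
      using that unfolding reflect_reflect
      by (auto simp: plus_def T_def refl_leb_def space_PiM fun_eq_iff extensional_def)
  qed
  have "emeasure (distr (leb k) (leb k) T) A = (\<integral>\<^sup>+x. indicator A x \<partial>distr (leb k) (leb k) T)"
    by simp
  also have "\<dots> = (\<integral>\<^sup>+x. indicator A (T x) \<partial>leb k)"
    by (rule nn_integral_distr) measurable
  \<comment> \<open>The weight \<open>G\<close> has integral 1. It is inserted as a function of a
    second variable y; for fixed y the inner integral may then be translated by T y.\<close>
  also have "\<dots> = (\<integral>\<^sup>+y. (\<integral>\<^sup>+x. indicator A (T x) \<partial>leb k) * G y \<partial>leb k)"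
    by (subst nn_integral_cmult) (simp_all add: G_def nn_integral_gauss_density)
  also have "\<dots> = (\<integral>\<^sup>+y. (\<integral>\<^sup>+x. indicator A (T (plus (T y) x)) * G y \<partial>leb k) \<partial>leb k)"
  proof (rule nn_integral_cong)
    fix y
    have eq: "(\<integral>\<^sup>+x. indicator A (T x) \<partial>leb k) = (\<integral>\<^sup>+x. indicator A (T (plus (T y) x)) \<partial>leb k)"
      unfolding plus_def by (rule nn_integral_translate_leb[symmetric]) measurable
    have Tp: "(\<lambda>x. T (plus (T y) x)) \<in> measurable (leb k) (leb k)"
      unfolding plus_def
      by (intro measurable_compose[OF _ T] measurable_into_leb) measurable
    have "(\<integral>\<^sup>+x. indicator A (T (plus (T y) x)) \<partial>leb k) * G y
        = (\<integral>\<^sup>+x. indicator A (T (plus (T y) x)) * G y \<partial>leb k)"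
      by (intro nn_integral_multc[symmetric] measurable_compose[OF Tp] borel_measurable_indicator A)
    then show "(\<integral>\<^sup>+x. indicator A (T x) \<partial>leb k) * G y = (\<integral>\<^sup>+x. indicator A (T (plus (T y) x)) * G y \<partial>leb k)" by (simp only: eq)
  qed
  also have "\<dots> = (\<integral>\<^sup>+y. (\<integral>\<^sup>+x. indicator A (plus (T x) y) * G y \<partial>leb k) \<partial>leb k)"
    by (intro nn_integral_cong) (simp add: T_plus)
  also have "\<dots> = (\<integral>\<^sup>+x. (\<integral>\<^sup>+y. indicator A (plus (T x) y) * G y \<partial>leb k) \<partial>leb k)"
  proof (rule leb_pair.Fubini')
    have [measurable]: "(\<lambda>p. plus (T (fst p)) (snd p)) \<in> measurable (leb k \<Otimes>\<^sub>M leb k) (leb k)"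
      by (rule plus_m) measurable
    show "(\<lambda>(x, y). indicator A (plus (T x) y) * G y) \<in> borel_measurable (leb k \<Otimes>\<^sub>M leb k)"
      by (simp add: split_beta')
  qed
  \<comment> \<open>For fixed x, translate y by - T x: the indicator is freed from T, and the shift
    moves into the weight.\<close>
  also have "\<dots> = (\<integral>\<^sup>+x. (\<integral>\<^sup>+y. indicator A y * G (\<lambda>i. y i - T x i) \<partial>leb k) \<partial>leb k)"
  proof (rule nn_integral_cong)
    fix x
    have "G (\<lambda>i. plus (T x) y i - T x i) = G y" for y
      by (rule G_cong, rule ip_cong) (auto simp: plus_def)
    then show "(\<integral>\<^sup>+y. indicator A (plus (T x) y) * G y \<partial>leb k) = (\<integral>\<^sup>+y. indicator A y * G (\<lambda>i. y i - T x i) \<partial>leb k)"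
      unfolding plus_def
      by (subst nn_integral_translate_leb[where a="T x", symmetric]) (auto simp: G_def)
  qed
  also have "\<dots> = (\<integral>\<^sup>+y. (\<integral>\<^sup>+x. indicator A y * G (\<lambda>i. y i - T x i) \<partial>leb k) \<partial>leb k)"
    using Ti by (intro leb_pair.Fubini'[symmetric]) (auto simp: split_beta' G_def intro!: measurable_gauss_density
      borel_measurable_times_ennreal borel_measurable_diff measurable_compose[OF measurable_fst] measurable_compose[OF measurable_snd])
  also have "\<dots> = (\<integral>\<^sup>+y. indicator A y * (\<integral>\<^sup>+x. G (plus (\<lambda>i. - T y i) x) \<partial>leb k) \<partial>leb k)"
  proof (rule nn_integral_cong)
    fix y
    \<comment> \<open>T is an isometric involution, so |y - T x| = |T y - x|. The weight is now a
      translate in x, its integral is again 1, and what remains is the measure of A.\<close>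
    have "G (\<lambda>i. y i - T x i) = G (plus (\<lambda>i. - T y i) x)" for x
    proof (rule G_cong)
      have "ip k (\<lambda>i. y i - T x i) (\<lambda>i. y i - T x i)
          = ip k (reflect k w (\<lambda>i. y i - T x i)) (reflect k w (\<lambda>i. y i - T x i))"
        by (simp add: ip_reflect_reflect)
      also have "reflect k w (\<lambda>i. y i - T x i) = (\<lambda>i. reflect k w y i - reflect k w (T x) i)"
        by (rule reflect_diff)
      also have "ip k \<dots> \<dots> = ip k (\<lambda>i. T y i - x i) (\<lambda>i. T y i - x i)"
      proof (rule ip_cong)
        fix i assume "i \<le> k"
        have "reflect k w (T x) i = reflect k w (reflect k w x) i"
          using \<open>i \<le> k\<close> by (intro reflect_cong) (simp_all add: T_def refl_leb_def)
        then show "reflect k w y i - reflect k w (T x) i = T y i - x i"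
          using \<open>i \<le> k\<close> by (simp add: reflect_reflect) (simp add: T_def refl_leb_def)
        then show "reflect k w y i - reflect k w (T x) i = T y i - x i" .
      qed
      also have "\<dots> = ip k (plus (\<lambda>i. - T y i) x) (plus (\<lambda>i. - T y i) x)"
        by (simp add: plus_def ip_def algebra_simps)
      finally show "ip k (\<lambda>i. y i - T x i) (\<lambda>i. y i - T x i) = \<dots>" .
    qed
    then have "(\<integral>\<^sup>+x. indicator A y * G (\<lambda>i. y i - T x i) \<partial>leb k)
        = (\<integral>\<^sup>+x. indicator A y * G (plus (\<lambda>i. - T y i) x) \<partial>leb k)"
      by (simp only:)
    also have "\<dots> = indicator A y * (\<integral>\<^sup>+x. G (plus (\<lambda>i. - T y i) x) \<partial>leb k)"
    proof (rule nn_integral_cmult)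
      have "(\<lambda>x. plus (\<lambda>i. - T y i) x) \<in> measurable (leb k) (leb k)"
        unfolding plus_def by (rule measurable_into_leb) measurable
      then show "(\<lambda>x. G (plus (\<lambda>i. - T y i) x)) \<in> borel_measurable (leb k)"
        by (rule measurable_compose[OF _ Gm])
    qed
    finally show "(\<integral>\<^sup>+x. indicator A y * G (\<lambda>i. y i - T x i) \<partial>leb k)
        = indicator A y * (\<integral>\<^sup>+x. G (plus (\<lambda>i. - T y i) x) \<partial>leb k)" .
  qed
  also have "\<dots> = (\<integral>\<^sup>+y. indicator A y \<partial>leb k)"
  proof (rule nn_integral_cong)
    fix y
    have "(\<integral>\<^sup>+x. G (plus (\<lambda>i. - T y i) x) \<partial>leb k) = (\<integral>\<^sup>+x. G x \<partial>leb k)"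
      unfolding plus_def by (rule nn_integral_translate_leb) measurable
    then show "indicator A y * (\<integral>\<^sup>+x. G (plus (\<lambda>i. - T y i) x) \<partial>leb k) = indicator A y"
      by (simp add: G_def nn_integral_gauss_density)
  qed
  also have "\<dots> = emeasure (leb k) A" by simp
  finally show "emeasure (distr (leb k) (leb k) (refl_leb k w)) A = emeasure (leb k) A"
    by (simp add: T_def)
qed simp

text \<open>Both ingredients of the density representation are invariant: Lebesgue measure by the
  preceding lemma, the density because a reflection preserves the norm.\<close>

lemma distr_refl_gauss: "distr (gauss k) (gauss k) (refl_leb k w) = gauss k"
proof (rule measure_eqI)
  fix A assume "A \<in> sets (distr (gauss k) (gauss k) (refl_leb k w))"
  then have A [measurable]: "A \<in> sets (leb k)" by (simp add: sets_gauss)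
  have d: "gauss_density k (refl_leb k w x) = gauss_density k x" for x
    by (simp add: gauss_density_def refl_leb_def ip_reflect_reflect)
  have "emeasure (distr (gauss k) (gauss k) (refl_leb k w)) A
      = emeasure (gauss k) (refl_leb k w -` A \<inter> space (leb k))"
    by (subst emeasure_distr) (auto simp: space_gauss sets_gauss measurable_cong_sets[OF sets_gauss sets_gauss])
  also have "\<dots> = (\<integral>\<^sup>+x. ennreal (gauss_density k (refl_leb k w x)) * indicator A (refl_leb k w x) \<partial>leb k)"
    unfolding gauss_eq_density d
    by (subst emeasure_density) (auto intro!: nn_integral_cong simp: indicator_def)
  also have "\<dots> = (\<integral>\<^sup>+x. ennreal (gauss_density k x) * indicator A x \<partial>distr (leb k) (leb k) (refl_leb k w))"
    by (subst nn_integral_distr) auto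
  also have "\<dots> = emeasure (gauss k) A"
    unfolding gauss_eq_density distr_refl_leb by (subst emeasure_density) auto
  finally show "emeasure (distr (gauss k) (gauss k) (refl_leb k w)) A = emeasure (gauss k) A" .
qed simp

text \<open>The reflection along u - e exchanges u with the first basis vector e and is
  self-adjoint. Any functional <h, u> thereby becomes a coordinate of a vector with the same
  Gaussian law, which reduces its distribution to one factor of the product.\<close>

lemma refl_leb_first:
  assumes "ip k u u = 1"
  shows "refl_leb k (u - (\<lambda>i. if i = 0 then 1 else 0)) h 0 = ip k h u"
proof -
  define e where "e = (\<lambda>i::nat. if i = 0 then 1 else 0 :: real)"
  have e: "ip k h e = h 0" for h
    unfolding ip_def e_def by (simp add: if_distrib cong: if_cong)
  have "refl_leb k (u - e) h 0 = ip k (reflect k (u - e) h) e" by (simp add: refl_leb_def e)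
  also have "\<dots> = ip k h (reflect k (u - e) e)" by (rule ip_reflect_self_adjoint)
  also have "\<dots> = ip k h u"
  proof (rule ip_cong)
    fix i assume "i \<le> k"
    have "ip k e e = 1" by (simp add: e) (simp add: e_def)
    then show "reflect k (u - e) e i = u i"
      using assms \<open>i \<le> k\<close> by (intro reflect_swap') simp_all
  qed simp
  finally show ?thesis by (simp only: e_def)
qed

lemma distr_gauss_ip:
  assumes "ip k u u = 1"
  shows "distr (gauss k) borel (\<lambda>h. ip k h u) = std_normal_distribution"
proof -
  define w where "w = u - (\<lambda>i::nat. if i = 0 then 1 else 0 :: real)"
  have "ip k h u = refl_leb k w h 0" for h
    unfolding w_def by (rule refl_leb_first[OF assms, symmetric])
  then have "distr (gauss k) borel (\<lambda>h. ip k h u) = distr (gauss k) borel (\<lambda>h. refl_leb k w h 0)"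
    by simp
  also have "\<dots> = distr (distr (gauss k) (gauss k) (refl_leb k w)) borel (\<lambda>h. h 0)"
    by (subst distr_distr) (auto simp: o_def measurable_cong_sets[OF sets_gauss sets_gauss])
  also have "\<dots> = distr (gauss k) borel (\<lambda>h. h 0)"
    by (simp add: distr_refl_gauss)
  also have "\<dots> = distr (gauss k) (std_normal_distribution) (\<lambda>h. h 0)"
    by (rule distr_cong) auto
  also have "\<dots> = std_normal_distribution"
    unfolding gauss_def by (rule distr_PiM_component) (simp_all add: std_normal.prob_space_axioms)
  finally show ?thesis .
qed

section \<open>The uniform measure on the sphere\<close>

definition uball :: "nat \<Rightarrow> (nat \<Rightarrow> real) set" where
  "uball k = {x \<in> space (leb k). L2_set x {..k} \<le> 1}"

definition radial :: "nat \<Rightarrow> (nat \<Rightarrow> real) \<Rightarrow> nat \<Rightarrow> real" where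
  "radial k x = (\<lambda>i. if i \<le> k then x i / L2_set x {..k} else 0)"

abbreviation ball_measure :: "nat \<Rightarrow> (nat \<Rightarrow> real) measure" where
  "ball_measure k \<equiv> uniform_measure (leb k) (uball k)"

lemma sphere_measure_eq:
  "sphere_measure k = restrict_space (distr (ball_measure k) borel (radial k)) (Sph k)"
  by (simp add: sphere_measure_def uball_def radial_def[abs_def])

lemma measurable_radial [measurable]: "radial k \<in> measurable (leb k) borel"
proof (rule measurable_coordinatewise_then_product)
  fix i show "(\<lambda>x. radial k x i) \<in> borel_measurable (leb k)"
    by (cases "i \<le> k") (simp_all add: radial_def L2_set_ip, measurable)
qed

lemma uball_sets [measurable]: "uball k \<in> sets (leb k)"
  unfolding uball_def L2_set_ip by measurable

lemma Sph_sets [measurable]: "Sph k \<in> sets borel"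
proof -
  have "{x \<in> space borel. ip k x x = 1 \<and> (\<forall>i\<in>{i. i > k}. x i = 0)} \<in> sets borel"
    by measurable
  also have "{x \<in> space borel. ip k x x = 1 \<and> (\<forall>i\<in>{i. i > k}. x i = 0)} = Sph k"
    by (auto simp: Sph_iff)
  finally show ?thesis .
qed

lemma emeasure_uball_less_top: "emeasure (leb k) (uball k) < \<top>"
proof -
  have "uball k \<subseteq> PiE {..k} (\<lambda>_. {-1..1})"
  proof
    fix x assume x: "x \<in> uball k"
    have "\<bar>x i\<bar> \<le> 1" if "i \<le> k" for i
    proof -
      have "\<bar>x i\<bar> \<le> L2_set (\<lambda>i. \<bar>x i\<bar>) {..k}" using that by (intro member_le_L2_set) auto
      also have "\<dots> = L2_set x {..k}" by (simp add: L2_set_def)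
      finally show ?thesis using x by (simp add: uball_def)
    qed
    then show "x \<in> PiE {..k} (\<lambda>_. {-1..1})"
      using x by (auto simp: uball_def space_PiM PiE_iff abs_le_iff)
  qed
  then have "emeasure (leb k) (uball k) \<le> emeasure (leb k) (PiE {..k} (\<lambda>_. {-1..1}))"
    by (rule emeasure_mono) (auto intro!: sets_PiM_I_finite)
  also have "\<dots> = 2 ^ (k + 1)" by (subst lborel_prod.emeasure_PiM) auto
  also have "\<dots> < \<top>" by (simp add: power_less_top_ennreal del: power_Suc)
  finally show ?thesis .
qed

lemma emeasure_uball_pos: "emeasure (leb k) (uball k) \<noteq> 0"
proof -
  \<comment> \<open>Chosen so that a point of the cube [0,d]^(k+1) has squared norm at most (k+1)
    d^2 = d <= 1.\<close>
  define d where "d = 1 / (real k + 1)"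
  have d: "d > 0" by (simp add: d_def)
  have "PiE {..k} (\<lambda>_. {0..d}) \<subseteq> uball k"
  proof
    fix x assume x: "x \<in> PiE {..k} (\<lambda>_. {0..d})"
    have "ip k x x \<le> (\<Sum>i\<le>k. d * d)"
      unfolding ip_def using x d by (intro sum_mono mult_mono) (auto simp: PiE_iff)
    also have "\<dots> = (real k + 1) * d * d" by (simp add: algebra_simps)
    also have "\<dots> = d" by (simp add: d_def)
    also have "\<dots> \<le> 1" by (simp add: d_def)
    finally show "x \<in> uball k" using x by (auto simp: uball_def L2_set_ip space_PiM PiE_iff)
  qed
  then have "emeasure (leb k) (PiE {..k} (\<lambda>_. {0..d})) \<le> emeasure (leb k) (uball k)"
    by (rule emeasure_mono) measurable
  moreover have "emeasure (leb k) (PiE {..k} (\<lambda>_. {0..d})) = ennreal d ^ (k + 1)"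
    using d by (subst lborel_prod.emeasure_PiM) auto
  moreover have "ennreal d ^ (k + 1) > 0" using d by (simp add: ennreal_power del: power_Suc)
  ultimately show ?thesis by auto
qed

interpretation ball: prob_space "ball_measure k" for k
  using emeasure_uball_pos emeasure_uball_less_top by (intro prob_space_uniform_measure) (auto simp: less_top)

lemma AE_radial_Sph: "AE x in ball_measure k. radial k x \<in> Sph k"
proof (rule AE_uniform_measureI)
  \<comment> \<open>Normalisation fails only at the origin. A coordinate hyperplane through it is a
    box with one side of length 0, so its nullity can be read off the product.\<close>
  define Z where "Z = PiE {..k} (\<lambda>i. if i = 0 then {0} else UNIV :: real set)"
  have "Z \<in> null_sets (leb k)"
  proof (rule null_setsI)
    show "Z \<in> sets (leb k)" unfolding Z_def by (auto intro!: sets_PiM_I_finite)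
    show "emeasure (leb k) Z = 0"
      unfolding Z_def by (subst lborel_prod.emeasure_PiM) auto
  qed
  moreover have "{x \<in> space (leb k). \<not> (x \<in> uball k \<longrightarrow> radial k x \<in> Sph k)} \<subseteq> Z"
  proof
    fix x assume x: "x \<in> {x \<in> space (leb k). \<not> (x \<in> uball k \<longrightarrow> radial k x \<in> Sph k)}"
    have "x 0 = 0"
    proof (rule ccontr)
      assume "x 0 \<noteq> 0"
      then have n: "ip k x x \<noteq> 0" by (auto simp: ip_self_eq_0_iff)
      have "ip k (radial k x) (radial k x) = ip k (\<lambda>i. inverse (L2_set x {..k}) * x i) (\<lambda>i. inverse (L2_set x {..k}) * x i)"
        by (intro ip_cong) (auto simp: radial_def field_simps)
      also have "\<dots> = 1"
        unfolding ip_linear L2_set_ip using n by (simp add: field_simps)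
      finally have "radial k x \<in> Sph k" by (auto simp: Sph_iff) (simp add: radial_def)
      with x show False by simp
    qed
    with x show "x \<in> Z" by (auto simp: Z_def space_PiM PiE_iff)
  qed
  ultimately show "AE x in leb k. x \<in> uball k \<longrightarrow> radial k x \<in> Sph k" by (rule AE_I')
qed measurable

lemma space_sphere_measure [simp]: "space (sphere_measure k) = Sph k"
  by (simp add: sphere_measure_eq space_restrict_space)

lemma sets_Collect_in:
  assumes "A \<in> sets M" "{z \<in> space M. P z} \<in> sets M" shows "{z \<in> A. P z} \<in> sets M"
proof -
  have "{z \<in> A. P z} = A \<inter> {z \<in> space M. P z}" using sets.sets_into_space[OF assms(1)] by auto
  then show ?thesis using assms by simp
qed

lemma sets_sphere_measure: "sets (sphere_measure k) = sets (restrict_space borel (Sph k))"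
  by (simp add: sphere_measure_eq sets_restrict_space)

lemma sets_sphere_iff: "A \<in> sets (sphere_measure k) \<longleftrightarrow> A \<subseteq> Sph k \<and> A \<in> sets borel"
  by (simp add: sets_sphere_measure sets_restrict_space_iff)

lemma emeasure_sphere_measure:
  assumes "A \<in> sets (sphere_measure k)"
  shows "emeasure (sphere_measure k) A = emeasure (distr (ball_measure k) borel (radial k)) A"
  unfolding sphere_measure_eq using assms
  by (subst emeasure_restrict_space) (auto simp: sets_sphere_iff)

interpretation sphere: prob_space "sphere_measure k" for k
proof
  have "emeasure (sphere_measure k) (space (sphere_measure k))
      = emeasure (ball_measure k) (radial k -` Sph k \<inter> space (ball_measure k))"
    by (subst emeasure_sphere_measure) (auto simp: sets_sphere_iff emeasure_distr)
  also have "\<dots> = emeasure (ball_measure k) (space (ball_measure k))"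
    using AE_radial_Sph[of k] by (intro emeasure_eq_AE) (auto intro: measurable_sets)
  finally show "emeasure (sphere_measure k) (space (sphere_measure k)) = 1"
    using ball.emeasure_space_1[of k] by (simp only:)
qed

interpretation sphere_gauss: pair_sigma_finite "sphere_measure k" "gauss k" for k
  by unfold_locales

lemma measurable_sphere_component [measurable]: "(\<lambda>z. z i) \<in> borel_measurable (sphere_measure k)"
  unfolding measurable_cong_sets[OF sets_sphere_measure refl]
  by (rule measurable_restrict_space1) (rule measurable_product_coordinates)

lemma measurable_sphere_ip [measurable]: "ip k u \<in> borel_measurable (sphere_measure k)"
  using measurable_ip[of k "\<lambda>_. u" "sphere_measure k" "\<lambda>z. z"] by simp

lemma measurable_ball_measure: "measurable (ball_measure k) N = measurable (leb k) N"
  "measurable N (ball_measure k) = measurable N (leb k)"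
  by (rule measurable_cong_sets; simp)+

lemma distr_refl_ball: "distr (ball_measure k) (ball_measure k) (refl_leb k w) = ball_measure k"
proof (rule measure_eqI)
  fix A assume "A \<in> sets (distr (ball_measure k) (ball_measure k) (refl_leb k w))"
  then have A [measurable]: "A \<in> sets (leb k)" by simp
  have "emeasure (distr (ball_measure k) (ball_measure k) (refl_leb k w)) A
     = emeasure (ball_measure k) (refl_leb k w -` A \<inter> space (leb k))"
    by (subst emeasure_distr) (simp_all add: measurable_ball_measure measurable_refl_leb)
  also have "\<dots> = emeasure (leb k) (refl_leb k w -` (uball k \<inter> A) \<inter> space (leb k)) / emeasure (leb k) (uball k)"
  proof (subst emeasure_uniform_measure)
    have "uball k \<inter> (refl_leb k w -` A \<inter> space (leb k)) = refl_leb k w -` (uball k \<inter> A) \<inter> space (leb k)"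
      using measurable_space[OF measurable_refl_leb]
      by (auto simp: uball_def L2_set_ip refl_leb_def ip_reflect_reflect)
    then show "emeasure (leb k) (uball k \<inter> (refl_leb k w -` A \<inter> space (leb k))) / emeasure (leb k) (uball k)
      = emeasure (leb k) (refl_leb k w -` (uball k \<inter> A) \<inter> space (leb k)) / emeasure (leb k) (uball k)" by simp
  qed measurable
  also have "emeasure (leb k) (refl_leb k w -` (uball k \<inter> A) \<inter> space (leb k))
      = emeasure (distr (leb k) (leb k) (refl_leb k w)) (uball k \<inter> A)"
    by (subst emeasure_distr) auto
  also have "\<dots> / emeasure (leb k) (uball k) = emeasure (ball_measure k) A"
    unfolding distr_refl_leb by (subst emeasure_uniform_measure) auto
  finally show "emeasure (distr (ball_measure k) (ball_measure k) (refl_leb k w)) A = emeasure (ball_measure k) A" .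
qed simp

lemma measurable_reflect [measurable]: "reflect k w \<in> measurable borel borel"
proof (rule measurable_coordinatewise_then_product)
  fix i show "(\<lambda>x. reflect k w x i) \<in> borel_measurable borel"
    unfolding reflect_def by measurable
qed

lemma reflect_Sph:
  assumes "\<And>i. i > k \<Longrightarrow> w i = 0" shows "reflect k w z \<in> Sph k \<longleftrightarrow> z \<in> Sph k"
  using assms by (simp add: Sph_iff ip_reflect_reflect) (simp add: reflect_def)

text \<open>Reflections preserve norms and so commute with radial projection; invariance passes from
  the ball to the sphere. As w vanishes beyond k, the reflection maps the sphere to itself.\<close>

lemma emeasure_sphere_reflect:
  assumes w: "\<And>i. i > k \<Longrightarrow> w i = 0" and A: "A \<in> sets (sphere_measure k)"
  shows "emeasure (sphere_measure k) {z \<in> Sph k. reflect k w z \<in> A} = emeasure (sphere_measure k) A"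
proof -
  have A' [measurable]: "A \<in> sets borel" and AS: "A \<subseteq> Sph k" using A by (auto simp: sets_sphere_iff)
  have eq: "{z \<in> Sph k. reflect k w z \<in> A} = reflect k w -` A \<inter> space borel"
    using AS reflect_Sph[OF w] by auto
  have m: "reflect k w -` A \<inter> space borel \<in> sets borel" by measurable
  have "reflect k w (radial k x) = radial k (refl_leb k w x)" for x
  proof
    fix i
    have ii: "L2_set (refl_leb k w x) {..k} = L2_set x {..k}"
      by (simp add: L2_set_ip refl_leb_def ip_reflect_reflect)
    have "ip k (radial k x) w = ip k (\<lambda>i. inverse (L2_set x {..k}) * x i) w"
      by (rule ip_cong) (auto simp: radial_def field_simps)
    then have "ip k (radial k x) w = inverse (L2_set x {..k}) * ip k x w" by (simp add: ip_linear)
    then show "reflect k w (radial k x) i = radial k (refl_leb k w x) i"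
      using w[of i] by (cases "i \<le> k") (simp_all add: reflect_def radial_def ii,
          simp_all add: refl_leb_def reflect_def diff_divide_distrib field_simps)
  qed
  then have "distr (distr (ball_measure k) borel (radial k)) borel (reflect k w)
      = distr (distr (ball_measure k) (ball_measure k) (refl_leb k w)) borel (radial k)"
    by (subst (1 2) distr_distr)
      (simp_all add: o_def measurable_ball_measure measurable_refl_leb measurable_radial measurable_reflect)
  also have "\<dots> = distr (ball_measure k) borel (radial k)" unfolding distr_refl_ball ..
  finally have "emeasure (distr (ball_measure k) borel (radial k)) A
     = emeasure (distr (distr (ball_measure k) borel (radial k)) borel (reflect k w)) A" by simp
  also have "\<dots> = emeasure (distr (ball_measure k) borel (radial k)) (reflect k w -` A \<inter> space borel)"
    by (subst emeasure_distr) auto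
  finally show ?thesis
    unfolding eq using m eq by (subst (1 2) emeasure_sphere_measure) (auto simp: sets_sphere_iff A AS)
qed

lemma AE_std_normal_neq: "AE x in std_normal_distribution. x \<noteq> c"
proof -
  have "AE x in lborel. x \<noteq> c" by (rule AE_lborel_singleton)
  then show ?thesis by (subst AE_density) auto
qed

lemma AE_gauss_ip_neq_0:
  assumes "ip k u u = 1" shows "AE h in gauss k. ip k h u \<noteq> 0"
proof -
  have "AE x in distr (gauss k) borel (\<lambda>h. ip k h u). x \<noteq> 0"
    unfolding distr_gauss_ip[OF assms] by (rule AE_std_normal_neq)
  then show ?thesis by (subst (asm) AE_distr_iff) auto
qed

text \<open>
  All unit vectors orthogonal to \<open>B\<close> see the same distribution, by a reflection fixing \<open>B\<close>; so the
  vector may be averaged over the direction of the component orthogonal to \<open>B\<close> of a Gaussian vector.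
\<close>

lemma sphere_gauss_average:
  assumes B: "orthonormal k B"
    and A [measurable]: "A \<in> sets (sphere_measure k)"
    and th [measurable]: "\<theta> \<in> borel_measurable (sphere_measure k)"
    and inv: "\<And>w z. \<lbrakk>z \<in> Sph k; \<And>i. i > k \<Longrightarrow> w i = 0; \<And>b. b \<in> B \<Longrightarrow> ip k w b = 0\<rbrakk>
        \<Longrightarrow> (reflect k w z \<in> A \<longleftrightarrow> z \<in> A) \<and> \<theta> (reflect k w z) = \<theta> z"
    and e: "ip k e e = 1" "\<And>i. i > k \<Longrightarrow> e i = 0" "\<And>b. b \<in> B \<Longrightarrow> ip k e b = 0"
  defines "p \<equiv> (\<lambda>h. h - proj k B h)"
  shows "emeasure (sphere_measure k) {z \<in> A. ip k e z \<le> \<theta> z}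
    = (\<integral>\<^sup>+z. emeasure (gauss k) {h \<in> space (gauss k). ip k (p h) z \<le> \<theta> z * sqrt (ip k (p h) (p h))}
         * indicator A z \<partial>sphere_measure k)"
proof -
  have pm [measurable]: "(\<lambda>h. p h i) \<in> borel_measurable (gauss k)" if "i \<le> k" for i
    unfolding p_def proj_def fun_diff_def using that by measurable
  have AS: "A \<subseteq> Sph k" using A by (simp add: sets_sphere_iff)
  \<comment> \<open>The normalised component f of h orthogonal to B is, like e, a unit vector
    orthogonal to B. The reflection along e - f exchanges them and fixes B, hence preserves A and
    \<theta>. The condition on h guarantees f exists: e is orthogonal to B, so <p h, e> = <h, e> is
    nonzero.\<close>
  have rotate: "emeasure (sphere_measure k) {z \<in> A. ip k (p h) z \<le> \<theta> z * sqrt (ip k (p h) (p h))}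
      = emeasure (sphere_measure k) {z \<in> A. ip k e z \<le> \<theta> z}" if "ip k h e \<noteq> 0" for h
  proof -
    define n where "n = sqrt (ip k (p h) (p h))"
    \<comment> \<open>Cut off beyond k, where a point h of the product space is undefined, so that
      the reflection vector e - f vanishes there.\<close>
    define f where "f = (\<lambda>i. if i \<le> k then inverse n * p h i else 0)"
    have he: "ip k (p h) e = ip k h e"
      using e(3) by (simp add: p_def ip_fun_linear ip_proj_left)
    have "ip k (p h) (p h) \<noteq> 0"
    proof
      assume "ip k (p h) (p h) = 0"
      then have "ip k (p h) e = ip k 0 e" by (intro ip_cong) (simp_all add: ip_self_eq_0_iff)
      with he that show False by (simp add: ip_fun_linear)
    qed
    then have n: "n > 0" "n * n = ip k (p h) (p h)" by (auto simp: n_def less_le)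
    have f: "ip k f v = inverse n * ip k (p h) v" for v
      unfolding ip_linear(3)[symmetric] by (rule ip_cong) (auto simp: f_def)
    have ff: "ip k f f = 1"
      unfolding f ip_commute[of k "p h" f] unfolding f n(2)[symmetric] using n(1) by (simp add: field_simps)
    have fb: "ip k f b = 0" if "b \<in> B" for b
      using ip_proj_basis[OF B that, of h] by (simp add: f) (simp add: p_def ip_fun_linear)
    define w where "w = e - f"
    have w0: "w i = 0" if "i > k" for i using that e(2) by (simp add: w_def f_def)
    have wb: "ip k w b = 0" if "b \<in> B" for b using that e(3) fb by (simp add: w_def ip_fun_linear)
    have we: "ip k e (reflect k w z) = ip k f z" for z
    proof -
      have "ip k e (reflect k w z) = ip k (reflect k w e) z" by (simp add: ip_reflect_self_adjoint)
      also have "\<dots> = ip k f z"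
        by (rule ip_cong) (use reflect_swap[of k e f] e(1) ff in \<open>simp_all add: w_def\<close>)
      finally show ?thesis .
    qed
    have "{z \<in> A. ip k e z \<le> \<theta> z} \<in> sets (sphere_measure k)" by (intro sets_Collect_in[OF A] borel_measurable_le) measurable
    then have "emeasure (sphere_measure k) {z \<in> A. ip k e z \<le> \<theta> z}
      = emeasure (sphere_measure k) {z \<in> Sph k. reflect k w z \<in> {z \<in> A. ip k e z \<le> \<theta> z}}"
      by (intro emeasure_sphere_reflect[symmetric] w0)
    also have "{z \<in> Sph k. reflect k w z \<in> {z \<in> A. ip k e z \<le> \<theta> z}}
       = {z \<in> A. ip k (p h) z \<le> \<theta> z * sqrt (ip k (p h) (p h))}"
      using inv[OF _ w0 wb] AS n(1) by (auto simp: we f field_simps simp flip: n_def)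
    finally show ?thesis ..
  qed
  have [measurable]: "(\<lambda>q. p (snd q) i) \<in> borel_measurable (sphere_measure k \<Otimes>\<^sub>M gauss k)" if "i \<le> k" for i
    using measurable_compose[OF measurable_snd pm[OF that]] .
  have [measurable]: "(\<lambda>q. fst q i) \<in> borel_measurable (sphere_measure k \<Otimes>\<^sub>M gauss k)" for i
    using measurable_compose[OF measurable_fst measurable_sphere_component] .
  have "emeasure (sphere_measure k) {z \<in> A. ip k e z \<le> \<theta> z}
      = (\<integral>\<^sup>+h. emeasure (sphere_measure k) {z \<in> A. ip k e z \<le> \<theta> z} \<partial>gauss k)"
    by (simp add: gauss.emeasure_space_1)
  also have "\<dots> = (\<integral>\<^sup>+h. emeasure (sphere_measure k) {z \<in> A. ip k (p h) z \<le> \<theta> z * sqrt (ip k (p h) (p h))} \<partial>gauss k)"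
    using AE_gauss_ip_neq_0[OF e(1)] by (intro nn_integral_cong_AE) (auto simp: rotate)
  also have "\<dots> = (\<integral>\<^sup>+h. (\<integral>\<^sup>+z. indicator A z * indicator {q. ip k (p (snd q)) (fst q) \<le> \<theta> (fst q) * sqrt (ip k (p (snd q)) (p (snd q)))} (z, h)
      \<partial>sphere_measure k) \<partial>gauss k)"
  proof (rule nn_integral_cong)
    fix h assume "h \<in> space (gauss k)"
    have "{z \<in> A. ip k (p h) z \<le> \<theta> z * sqrt (ip k (p h) (p h))} \<in> sets (sphere_measure k)"
      by (intro sets_Collect_in[OF A] borel_measurable_le) measurable
    then show "emeasure (sphere_measure k) {z \<in> A. ip k (p h) z \<le> \<theta> z * sqrt (ip k (p h) (p h))}
      = (\<integral>\<^sup>+z. indicator A z * indicator {q. ip k (p (snd q)) (fst q) \<le> \<theta> (fst q) * sqrt (ip k (p (snd q)) (p (snd q)))} (z, h)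
      \<partial>sphere_measure k)"
      by (intro trans[OF nn_integral_indicator[symmetric]] nn_integral_cong) (auto simp: indicator_def)
  qed
  also have "\<dots> = (\<integral>\<^sup>+z. (\<integral>\<^sup>+h. indicator A z * indicator {q. ip k (p (snd q)) (fst q) \<le> \<theta> (fst q) * sqrt (ip k (p (snd q)) (p (snd q)))} (z, h)
      \<partial>gauss k) \<partial>sphere_measure k)"
  proof (rule sphere_gauss.Fubini')
    have "Measurable.pred (sphere_measure k \<Otimes>\<^sub>M gauss k)
       (\<lambda>q. ip k (p (snd q)) (fst q) \<le> \<theta> (fst q) * sqrt (ip k (p (snd q)) (p (snd q))))"
      by measurable
    then show "(\<lambda>(z, h). indicator A z * indicator {q. ip k (p (snd q)) (fst q) \<le> \<theta> (fst q) * sqrt (ip k (p (snd q)) (p (snd q)))} (z, h) :: ennreal)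
       \<in> borel_measurable (sphere_measure k \<Otimes>\<^sub>M gauss k)"
      unfolding split_beta'
      by (intro borel_measurable_times_ennreal borel_measurable_indicator') (auto simp: pred_def)
  qed
  also have "\<dots> = (\<integral>\<^sup>+z. emeasure (gauss k) {h \<in> space (gauss k). ip k (p h) z \<le> \<theta> z * sqrt (ip k (p h) (p h))}
         * indicator A z \<partial>sphere_measure k)"
  proof (rule nn_integral_cong)
    fix z
    have "{h \<in> space (gauss k). ip k (p h) z \<le> \<theta> z * sqrt (ip k (p h) (p h))} \<in> sets (gauss k)" by measurable
    then have "emeasure (gauss k) {h \<in> space (gauss k). ip k (p h) z \<le> \<theta> z * sqrt (ip k (p h) (p h))}
      = (\<integral>\<^sup>+h. indicator {q. ip k (p (snd q)) (fst q) \<le> \<theta> (fst q) * sqrt (ip k (p (snd q)) (p (snd q)))} (z, h) \<partial>gauss k)"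
      by (intro trans[OF nn_integral_indicator[symmetric]] nn_integral_cong) (auto simp: indicator_def)
    then show "(\<integral>\<^sup>+h. indicator A z * indicator {q. ip k (p (snd q)) (fst q) \<le> \<theta> (fst q) * sqrt (ip k (p (snd q)) (p (snd q)))} (z, h) \<partial>gauss k)
      = emeasure (gauss k) {h \<in> space (gauss k). ip k (p h) z \<le> \<theta> z * sqrt (ip k (p h) (p h))} * indicator A z"
      by (cases "z \<in> A") auto
  qed
  finally show ?thesis .
qed

section \<open>Gaussian half-space probabilities\<close>

lemma cdf_std_normal_diff_bounds:
  assumes "x \<le> y" "\<And>t. x \<le> t \<Longrightarrow> t \<le> y \<Longrightarrow> m \<le> std_normal_density t"
    "\<And>t. x \<le> t \<Longrightarrow> t \<le> y \<Longrightarrow> std_normal_density t \<le> M"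
  shows "m * (y - x) \<le> cdf std_normal_distribution y - cdf std_normal_distribution x"
    and "cdf std_normal_distribution y - cdf std_normal_distribution x \<le> M * (y - x)"
proof -
  have M: "0 \<le> M" using assms(1) assms(3)[of x] normal_density_nonneg[of 0 1 x] by linarith
  have eq: "ennreal (cdf std_normal_distribution y - cdf std_normal_distribution x)
      = (\<integral>\<^sup>+t. ennreal (std_normal_density t) * indicator {x<..y} t \<partial>lborel)"
  proof (cases "x < y")
    case True
    then have "ennreal (cdf std_normal_distribution y - cdf std_normal_distribution x)
        = emeasure std_normal_distribution {x<..y}"
      by (simp add: std_normal.cdf_diff_eq std_normal.emeasure_eq_measure)
    then show ?thesis by (simp add: emeasure_density)
  qed (use assms(1) in simp)
  have "(\<integral>\<^sup>+t. ennreal (std_normal_density t) * indicator {x<..y} t \<partial>lborel)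
      \<le> (\<integral>\<^sup>+t. ennreal M * indicator {x<..y} t \<partial>lborel)"
    using assms(3) by (intro nn_integral_mono) (auto simp: indicator_def intro!: ennreal_leI)
  also have "\<dots> = ennreal (M * (y - x))"
    using assms(1) M by (simp add: nn_integral_cmult_indicator ennreal_mult)
  finally show "cdf std_normal_distribution y - cdf std_normal_distribution x \<le> M * (y - x)"
    using M assms(1) unfolding eq[symmetric] by (subst (asm) ennreal_le_iff) auto
  have nn: "cdf std_normal_distribution y - cdf std_normal_distribution x \<ge> 0"
    using std_normal.cdf_nondecreasing[OF assms(1)] by simp
  have "ennreal m * ennreal (y - x) = (\<integral>\<^sup>+t. ennreal m * indicator {x<..y} t \<partial>lborel)"
    using assms(1) by (simp add: nn_integral_cmult_indicator)
  also have "\<dots> \<le> (\<integral>\<^sup>+t. ennreal (std_normal_density t) * indicator {x<..y} t \<partial>lborel)"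
    using assms(2) by (intro nn_integral_mono) (auto simp: indicator_def intro!: ennreal_leI)
  finally have *: "ennreal m * ennreal (y - x) \<le> ennreal (cdf std_normal_distribution y - cdf std_normal_distribution x)"
    unfolding eq .
  \<comment> \<open>The lower bound m may be negative, as in the Taylor estimate, where it is a
    density minus |h|. The integral in extended nonnegative reals truncates such m to 0, so
    monotonicity of the distribution function settles that case.\<close>
  show "m * (y - x) \<le> cdf std_normal_distribution y - cdf std_normal_distribution x"
  proof (cases "m \<ge> 0")
    case True
    then show ?thesis using * nn assms(1) by (simp flip: ennreal_mult)
  next
    case False
    then have "m * (y - x) \<le> 0" using assms(1) by (simp add: mult_nonpos_nonneg)
    with nn show ?thesis by linarith
  qed
qed

lemma std_normal_density_le_1: "std_normal_density x \<le> 1"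
proof -
  have "1 \<le> sqrt (2 * pi)" using pi_gt3 by simp
  then have "exp (- x\<^sup>2 / 2) \<le> sqrt (2 * pi)" by (rule order_trans[rotated]) simp
  then show ?thesis using pi_gt3 by (simp add: std_normal_density_def divide_simps)
qed

lemma std_normal_density_lipschitz: "\<bar>std_normal_density x - std_normal_density y\<bar> \<le> \<bar>x - y\<bar>"
proof -
  have d: "(std_normal_density has_field_derivative (- z * std_normal_density z)) (at z)" for z
  proof -
    define c where "c = 1 / sqrt (2 * pi)"
    have "std_normal_density = (\<lambda>x. c * exp (- x\<^sup>2 / 2))" by (simp add: std_normal_density_def c_def fun_eq_iff)
    then show ?thesis by (auto intro!: derivative_eq_intros)
  qed
  have b: "norm (- z * std_normal_density z) \<le> 1" for z
  proof -
    \<comment> \<open>From |z| <= 1 + z^2/2 <= exp(z^2/2) the derivative - z \<phi>(z) of the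
      density \<phi> is bounded by 1.\<close>
    have "2 * \<bar>z\<bar> \<le> 1 + z\<^sup>2" using sum_power2_ge_zero[of "\<bar>z\<bar> - 1" 0] by (simp add: power2_diff)
    then have "\<bar>z\<bar> \<le> 1 + z\<^sup>2 / 2" by simp
    also have "\<dots> \<le> exp (z\<^sup>2 / 2)" by simp
    finally have "\<bar>z\<bar> * exp (- z\<^sup>2 / 2) \<le> 1" by (simp add: exp_minus divide_simps)
    moreover have "1 \<le> sqrt (2 * pi)" using pi_gt3 by simp
    ultimately have "\<bar>z\<bar> * exp (- z\<^sup>2 / 2) \<le> sqrt (2 * pi)" by linarith
    then show ?thesis using pi_gt3 by (simp add: std_normal_density_def abs_mult divide_simps)
  qed
  have "norm (std_normal_density x - std_normal_density y) \<le> 1 * norm (x - y)"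
    by (rule field_differentiable_bound[of UNIV _ "\<lambda>z. - z * std_normal_density z"])
      (use d b in auto)
  then show ?thesis by simp
qed

lemma cdf_std_normal_lipschitz:
  "\<bar>cdf std_normal_distribution x - cdf std_normal_distribution y\<bar> \<le> \<bar>x - y\<bar>"
proof (induction x y rule: linorder_wlog)
  case (le x y)
  have "0 * (y - x) \<le> cdf std_normal_distribution y - cdf std_normal_distribution x"
    "cdf std_normal_distribution y - cdf std_normal_distribution x \<le> 1 * (y - x)"
    using cdf_std_normal_diff_bounds[OF le, of 0 1] by (simp_all add: std_normal_density_le_1)
  then show ?case by simp
qed (simp add: abs_minus_commute)

text \<open>Between x and x + h the density differs from its value at x by at most |h|; integrating
  over an interval of length |h| gives the error h^2. The two signs of h differ only in which
  endpoint is the left one.\<close>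

lemma cdf_std_normal_taylor:
  "\<bar>cdf std_normal_distribution (x + h) - cdf std_normal_distribution x - h * std_normal_density x\<bar> \<le> h\<^sup>2"
proof -
  have b: "std_normal_density x - \<bar>h\<bar> \<le> std_normal_density t" "std_normal_density t \<le> std_normal_density x + \<bar>h\<bar>"
    if "\<bar>t - x\<bar> \<le> \<bar>h\<bar>" for t
    using std_normal_density_lipschitz[of t x] that by linarith+
  show ?thesis
  proof (cases "h \<ge> 0")
    case True
    have "(std_normal_density x - \<bar>h\<bar>) * (x + h - x) \<le> cdf std_normal_distribution (x + h) - cdf std_normal_distribution x"
      "cdf std_normal_distribution (x + h) - cdf std_normal_distribution x \<le> (std_normal_density x + \<bar>h\<bar>) * (x + h - x)"
      using True by (intro cdf_std_normal_diff_bounds[where m="std_normal_density x - \<bar>h\<bar>"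
            and M="std_normal_density x + \<bar>h\<bar>"] b; simp)+
    then show ?thesis using True by (simp add: algebra_simps power2_eq_square abs_le_iff)
  next
    case False
    have "(std_normal_density x - \<bar>h\<bar>) * (x - (x + h)) \<le> cdf std_normal_distribution x - cdf std_normal_distribution (x + h)"
      "cdf std_normal_distribution x - cdf std_normal_distribution (x + h) \<le> (std_normal_density x + \<bar>h\<bar>) * (x - (x + h))"
      using False by (intro cdf_std_normal_diff_bounds[where m="std_normal_density x - \<bar>h\<bar>"
            and M="std_normal_density x + \<bar>h\<bar>"] b; simp)+
    then show ?thesis using False by (simp add: algebra_simps power2_eq_square abs_le_iff)
  qed
qed

lemma cdf_std_normal_strict_mono:
  assumes "x < y" shows "cdf std_normal_distribution x < cdf std_normal_distribution y"
proof -
  \<comment> \<open>The density decreases in |t|, and |x| + |y| dominates |t| on the whole interval: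
    a positive lower bound for the density.\<close>
  define m where "m = std_normal_density (\<bar>x\<bar> + \<bar>y\<bar>)"
  have "m * (y - x) \<le> cdf std_normal_distribution y - cdf std_normal_distribution x"
  proof (rule cdf_std_normal_diff_bounds)
    fix t assume t: "x \<le> t" "t \<le> y"
    then have "\<bar>t\<bar> \<le> \<bar>x\<bar> + \<bar>y\<bar>" by linarith
    then have "t\<^sup>2 \<le> (\<bar>x\<bar> + \<bar>y\<bar>)\<^sup>2" by (simp add: abs_le_square_iff[symmetric])
    then show "m \<le> std_normal_density t"
      unfolding m_def std_normal_density_def by (intro mult_left_mono) auto
    show "std_normal_density t \<le> 1" by (rule std_normal_density_le_1)
  qed (use assms in simp)
  moreover have "m > 0" unfolding m_def by (rule normal_density_pos) simp
  ultimately show ?thesis using assms by (smt (verit) mult_pos_pos)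
qed

lemma isCont_cdf_std_normal: "isCont (cdf std_normal_distribution) x"
proof -
  have "1-lipschitz_on UNIV (cdf std_normal_distribution)"
    using cdf_std_normal_lipschitz by (auto intro!: lipschitz_onI simp: dist_real_def)
  then show ?thesis by (metis lipschitz_on_continuous_on continuous_on_eq_continuous_at open_UNIV UNIV_I)
qed

text \<open>By symmetry the two closed half-lines at 0 have equal mass; they overlap in a point that
  is no atom, so the masses add up to 1.\<close>

lemma cdf_std_normal_0: "cdf std_normal_distribution 0 = 1 / 2"
proof -
  have "emeasure std_normal_distribution {..0} = (\<integral>\<^sup>+t. ennreal (std_normal_density t) * indicator {..0} t \<partial>lborel)"
    by (simp add: emeasure_density)
  also have "\<dots> = (\<integral>\<^sup>+t. ennreal (std_normal_density (- t)) * indicator {..0} (- t) \<partial>lborel)"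
    by (subst nn_integral_real_affine[where c="-1" and t=0]) auto
  also have "\<dots> = (\<integral>\<^sup>+t. ennreal (std_normal_density t) * indicator {0..} t \<partial>lborel)"
    by (intro nn_integral_cong) (auto simp: std_normal_density_def indicator_def)
  also have "\<dots> = emeasure std_normal_distribution {0..}"
    by (simp add: emeasure_density)
  finally have e: "measure std_normal_distribution {..0} = measure std_normal_distribution {0..}"
    by (simp add: measure_def)
  have "measure std_normal_distribution {0} = 0"
    using isCont_cdf_std_normal std_normal.isCont_cdf by blast
  moreover have "measure std_normal_distribution ({..0} \<union> ({0..} - {0}))
      = measure std_normal_distribution {..0} + measure std_normal_distribution ({0..} - {0})"
    by (rule std_normal.finite_measure_Union) auto
  moreover have "measure std_normal_distribution ({0..} - {0}) = measure std_normal_distribution {0..} - measure std_normal_distribution {0}"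
    by (rule std_normal.finite_measure_Diff) auto
  moreover have "{..0} \<union> ({0..} - {0}) = (UNIV :: real set)" by auto
  ultimately show ?thesis
    using e std_normal.prob_space by (simp add: cdf_def)
qed

section \<open>Concentration of the norm of a Gaussian vector\<close>

lemma std_normal_centered_square:
  "integrable std_normal_distribution (\<lambda>x. x\<^sup>2 - 1)" "(\<integral>x. x\<^sup>2 - 1 \<partial>std_normal_distribution) = 0"
  "integrable std_normal_distribution (\<lambda>x. (x\<^sup>2 - 1)\<^sup>2)" "(\<integral>x. (x\<^sup>2 - 1)\<^sup>2 \<partial>std_normal_distribution) = 2"
  "integrable std_normal_distribution (\<lambda>x. x\<^sup>2)" "(\<integral>x. x\<^sup>2 \<partial>std_normal_distribution) = 1"
proof -
  have m2: "integrable std_normal_distribution (\<lambda>x. x\<^sup>2)" "(\<integral>x. x\<^sup>2 \<partial>std_normal_distribution) = 1"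
    using std_normal_distribution_even_moments[of 1] by (simp_all add: fact_numeral)
  have m4: "integrable std_normal_distribution (\<lambda>x. x^4)" "(\<integral>x. x^4 \<partial>std_normal_distribution) = 3"
    using std_normal_distribution_even_moments[of 2] by (simp_all add: fact_numeral)
  have e: "(x\<^sup>2 - 1)\<^sup>2 = x^4 - 2 * x\<^sup>2 + 1" for x :: real
    by (simp add: power2_diff)
  show "integrable std_normal_distribution (\<lambda>x. x\<^sup>2 - 1)" using m2(1) by simp
  show "(\<integral>x. x\<^sup>2 - 1 \<partial>std_normal_distribution) = 0" using m2 std_normal.prob_space by simp
  show "integrable std_normal_distribution (\<lambda>x. (x\<^sup>2 - 1)\<^sup>2)" unfolding e using m2(1) m4(1) by simp
  show "(\<integral>x. (x\<^sup>2 - 1)\<^sup>2 \<partial>std_normal_distribution) = 2" unfolding e using m2 m4 std_normal.prob_space by simp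
qed (use std_normal_distribution_even_moments[of 1] in \<open>simp_all add: fact_numeral\<close>)

text \<open>Chebyshev for the sum of the k+1 independent centred variables h_i^2 - 1, each of
  variance 3 - 2 + 1 = 2.\<close>

lemma gauss_norm_concentration:
  assumes "a > 0"
  shows "measure (gauss k) {h \<in> space (gauss k). a \<le> \<bar>ip k h h - real (k + 1)\<bar>} \<le> 2 * real (k + 1) / a\<^sup>2"
proof -
  \<comment> \<open>The product of the variables with indices i and j, written as a product over all
    coordinates l, so that the integral factorises. For i = j both factors meet at one coordinate;
    for i different from j a factor of mean 0 appears.\<close>
  define f where "f i j l x = (if l = i then x\<^sup>2 - 1 else 1) * (if l = j then x\<^sup>2 - 1 else (1::real))" for i j l :: nat and x
  have fi: "integrable std_normal_distribution (f i j l)" for i j l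
    using std_normal_centered_square(1,3)
    by (cases "l = i"; cases "l = j") (simp_all add: f_def[abs_def] power2_eq_square)
  have fprod: "(\<Prod>l\<le>k. f i j l (h l)) = ((h i)\<^sup>2 - 1) * ((h j)\<^sup>2 - 1)" if "i \<le> k" "j \<le> k" for i j h
    using that by (simp add: f_def prod.distrib)
  have int: "integrable (gauss k) (\<lambda>h. ((h i)\<^sup>2 - 1) * ((h j)\<^sup>2 - 1))" if "i \<le> k" "j \<le> k" for i j
    using normal_prod.product_integrable_prod[of "{..k}" "f i j"] fi that
    unfolding gauss_def by (simp add: fprod)
  have ev: "(\<integral>h. ((h i)\<^sup>2 - 1) * ((h j)\<^sup>2 - 1) \<partial>gauss k) = (if i = j then 2 else 0)" if "i \<le> k" "j \<le> k" for i j
  proof -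
    have "(\<integral>h. ((h i)\<^sup>2 - 1) * ((h j)\<^sup>2 - 1) \<partial>gauss k) = (\<Prod>l\<le>k. \<integral>x. f i j l x \<partial>std_normal_distribution)"
      using normal_prod.product_integral_prod[of "{..k}" "f i j"] fi that
      unfolding gauss_def by (simp add: fprod)
    also have "\<dots> = (if i = j then 2 else 0)"
    proof (cases "i = j")
      case True
      then have "(\<integral>x. f i j l x \<partial>std_normal_distribution) = (if l = i then 2 else 1)" for l
        using std_normal_centered_square(4) std_normal.prob_space by (simp add: f_def power2_eq_square)
      with True that show ?thesis by simp
    next
      case False
      then have "(\<integral>x. f i j i x \<partial>std_normal_distribution) = 0"
        using std_normal_centered_square(2) by (simp add: f_def)
      with False that show ?thesis by (auto simp: prod_zero_iff)
    qed
    finally show ?thesis .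
  qed
  define S where "S h = (ip k h h - real (k + 1))\<^sup>2" for h
  have S: "S h = (\<Sum>i\<le>k. \<Sum>j\<le>k. ((h i)\<^sup>2 - 1) * ((h j)\<^sup>2 - 1))" for h
  proof -
    have "ip k h h - real (k + 1) = (\<Sum>i\<le>k. (h i)\<^sup>2 - 1)"
      by (simp add: ip_def sum_subtractf power2_eq_square)
    then show ?thesis unfolding S_def power2_eq_square[of "_ - real (k + 1)"] by (simp add: sum_product)
  qed
  have iS: "integrable (gauss k) S"
    unfolding S[abs_def] by (intro Bochner_Integration.integrable_sum int) auto
  have "(\<integral>h. S h \<partial>gauss k) = (\<Sum>i\<le>k. \<Sum>j\<le>k. if i = j then 2 else 0)"
    unfolding S by (subst Bochner_Integration.integral_sum, force intro: Bochner_Integration.integrable_sum int,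
      rule sum.cong, simp, subst Bochner_Integration.integral_sum, force intro: int, rule sum.cong) (auto simp: ev)
  also have "\<dots> = 2 * real (k + 1)" by simp
  finally have ES: "(\<integral>h. S h \<partial>gauss k) = 2 * real (k + 1)" .
  have "measure (gauss k) {h \<in> space (gauss k). a\<^sup>2 \<le> S h} \<le> (\<integral>h. S h \<partial>gauss k) / a\<^sup>2"
    using assms by (intro integral_Markov_inequality_measure[where A="{}"] iS) (auto simp: S_def)
  also have "{h \<in> space (gauss k). a\<^sup>2 \<le> S h} = {h \<in> space (gauss k). a \<le> \<bar>ip k h h - real (k + 1)\<bar>}"
    using assms by (auto simp: S_def abs_le_square_iff[symmetric])
  finally show ?thesis unfolding ES .
qed

text \<open>Markov's inequality: each <h, b> is standard normal, so the expected squared length of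
  the projection is the number of basis vectors.\<close>

lemma gauss_proj_concentration:
  assumes B: "orthonormal k B" and "a > 0"
  shows "measure (gauss k) {h \<in> space (gauss k). a \<le> (\<Sum>b\<in>B. (ip k h b)\<^sup>2)} \<le> real (card B) / a"
proof -
  have u: "ip k b b = 1" if "b \<in> B" for b using B that by (simp add: orthonormal_def)
  have i: "integrable (gauss k) (\<lambda>h. (ip k h b)\<^sup>2)" "(\<integral>h. (ip k h b)\<^sup>2 \<partial>gauss k) = 1" if "b \<in> B" for b
  proof -
    have m: "(\<lambda>h. ip k h b) \<in> measurable (gauss k) borel" by measurable
    show "integrable (gauss k) (\<lambda>h. (ip k h b)\<^sup>2)"
      using integrable_distr[OF m, of "\<lambda>x. x\<^sup>2"] std_normal_centered_square(5)
      unfolding distr_gauss_ip[OF u[OF that]] by simp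
    show "(\<integral>h. (ip k h b)\<^sup>2 \<partial>gauss k) = 1"
      using integral_distr[OF m, of "\<lambda>x. x\<^sup>2"] std_normal_centered_square(6)
      unfolding distr_gauss_ip[OF u[OF that]] by simp
  qed
  have "measure (gauss k) {h \<in> space (gauss k). a \<le> (\<Sum>b\<in>B. (ip k h b)\<^sup>2)}
      \<le> (\<integral>h. (\<Sum>b\<in>B. (ip k h b)\<^sup>2) \<partial>gauss k) / a"
    using assms i by (intro integral_Markov_inequality_measure[where A="{}"]) (auto intro!: sum_nonneg)
  also have "(\<integral>h. (\<Sum>b\<in>B. (ip k h b)\<^sup>2) \<partial>gauss k) = real (card B)"
    using i by (subst Bochner_Integration.integral_sum) auto
  finally show ?thesis .
qed

text \<open>By Pythagoras the squared length is |h|^2 minus that of the projection, and each of the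
  two may deviate by \<delta> k / 2. The requirement \<delta> k >= 2 absorbs the mean being k+1
  instead of k.\<close>

lemma gauss_norm_minus_proj:
  assumes B: "orthonormal k B" and k: "k \<ge> 1" and d: "\<delta> > 0" "\<delta> * real k \<ge> 2"
  shows "measure (gauss k) {h \<in> space (gauss k).
      \<not> ((1 - \<delta>) * real k \<le> ip k (h - proj k B h) (h - proj k B h) \<and>
         ip k (h - proj k B h) (h - proj k B h) \<le> (1 + \<delta>) * real k)}
    \<le> 16 / (\<delta>\<^sup>2 * real k) + 2 * real (card B) / (\<delta> * real k)" (is "measure _ ?Bad \<le> _")
proof -
  define a where "a = \<delta> * real k / 2"
  have a: "a > 0" using d(1) k by (simp add: a_def)
  have fin: "finite B" using B by (simp add: orthonormal_def)
  let ?A1 = "{h \<in> space (gauss k). a \<le> \<bar>ip k h h - real (k + 1)\<bar>}"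
  let ?A2 = "{h \<in> space (gauss k). a \<le> (\<Sum>b\<in>B. (ip k h b)\<^sup>2)}"
  have n: "ip k (h - proj k B h) (h - proj k B h) = ip k h h - (\<Sum>b\<in>B. (ip k h b)\<^sup>2)" for h
  proof -
    have "ip k (h - proj k B h) (h - proj k B h)
        = ip k h h - 2 * ip k (proj k B h) h + ip k (proj k B h) (proj k B h)"
      unfolding ip_fun_linear ip_commute[of k h "proj k B h"] by simp
    also have "\<dots> = ip k h h - (\<Sum>b\<in>B. ip k h b * ip k h b)"
      unfolding ip_proj_proj[OF B] unfolding ip_proj_left by simp
    finally show ?thesis by (simp add: power2_eq_square)
  qed
  have "?Bad \<subseteq> ?A1 \<union> ?A2"
  proof
    fix h assume h: "h \<in> ?Bad"
    have "(\<Sum>b\<in>B. (ip k h b)\<^sup>2) \<ge> 0" by (intro sum_nonneg) auto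
    then show "h \<in> ?A1 \<union> ?A2"
      using h d(2) unfolding n a_def by (auto simp: algebra_simps abs_if split: if_splits)
  qed
  then have "measure (gauss k) ?Bad \<le> measure (gauss k) (?A1 \<union> ?A2)"
    using fin by (intro gauss.finite_measure_mono) measurable
  also have "\<dots> \<le> measure (gauss k) ?A1 + measure (gauss k) ?A2"
    using fin by (intro measure_Un_le) measurable
  also have "\<dots> \<le> 2 * real (k + 1) / a\<^sup>2 + real (card B) / a"
    using gauss_norm_concentration[OF a, of k] gauss_proj_concentration[OF B a] by linarith
  also have "2 * real (k + 1) / a\<^sup>2 \<le> 4 * real k / a\<^sup>2"
    using k by (intro divide_right_mono) auto
  also have "4 * real k / a\<^sup>2 + real (card B) / a = 16 / (\<delta>\<^sup>2 * real k) + 2 * real (card B) / (\<delta> * real k)"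
    using d(1) k by (simp add: a_def power2_eq_square field_simps)
  finally show ?thesis by simp
qed

lemma measure_gauss_ip_le:
  assumes "ip k u u = 1"
  shows "measure (gauss k) {h \<in> space (gauss k). ip k h u \<le> s} = cdf std_normal_distribution s"
proof -
  have "measure (distr (gauss k) borel (\<lambda>h. ip k h u)) {..s} = measure (gauss k) ((\<lambda>h. ip k h u) -` {..s} \<inter> space (gauss k))"
    by (rule measure_distr) measurable
  then show ?thesis
    unfolding distr_gauss_ip[OF assms] cdf_def by (simp add: vimage_def Int_def conj_commute)
qed

text \<open>Outside an event of probability \<eta> the random threshold lies within |\<tau>|
  \<delta> of \<tau>, so the event is enclosed between two half-spaces, whose probabilities differ
  little as the normal distribution function is 1-Lipschitz. No independence of \<open>X\<close>
  from <h, u> enters.\<close>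

lemma gauss_random_threshold:
  assumes u: "ip k u u = 1" and X [measurable]: "X \<in> borel_measurable (gauss k)"
    and "\<delta> \<ge> 0" and bad: "measure (gauss k) {h \<in> space (gauss k). \<not> \<bar>X h - 1\<bar> \<le> \<delta>} \<le> \<eta>"
  shows "\<bar>measure (gauss k) {h \<in> space (gauss k). ip k h u \<le> \<tau> * X h} - cdf std_normal_distribution \<tau>\<bar>
      \<le> \<eta> + \<bar>\<tau>\<bar> * \<delta>"
proof -
  let ?P = "\<lambda>Q. {h \<in> space (gauss k). Q h}"
  let ?Bad = "?P (\<lambda>h. \<not> \<bar>X h - 1\<bar> \<le> \<delta>)"
  have close: "\<bar>\<tau> * X h - \<tau>\<bar> \<le> \<bar>\<tau>\<bar> * \<delta>" if "\<bar>X h - 1\<bar> \<le> \<delta>" for h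
  proof -
    have "\<tau> * X h - \<tau> = \<tau> * (X h - 1)" by (simp add: algebra_simps)
    then show ?thesis using mult_left_mono[OF that abs_ge_zero[of \<tau>]] by (simp add: abs_mult)
  qed
  define D where "D = \<bar>\<tau>\<bar> * \<delta>"
  have cl: "\<bar>cdf std_normal_distribution (\<tau> + D) - cdf std_normal_distribution \<tau>\<bar> \<le> \<bar>D\<bar>"
    "\<bar>cdf std_normal_distribution (\<tau> - D) - cdf std_normal_distribution \<tau>\<bar> \<le> \<bar>D\<bar>"
    using cdf_std_normal_lipschitz[of "\<tau> + D" \<tau>] cdf_std_normal_lipschitz[of "\<tau> - D" \<tau>] by simp_all
  have "measure (gauss k) (?P (\<lambda>h. ip k h u \<le> \<tau> * X h)) \<le> measure (gauss k) (?P (\<lambda>h. ip k h u \<le> \<tau> + D) \<union> ?Bad)"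
    by (rule gauss.finite_measure_mono) (use close in \<open>fastforce simp: D_def\<close>, measurable)
  also have "\<dots> \<le> measure (gauss k) (?P (\<lambda>h. ip k h u \<le> \<tau> + D)) + measure (gauss k) ?Bad"
    by (rule measure_Un_le) measurable
  finally have 1: "measure (gauss k) (?P (\<lambda>h. ip k h u \<le> \<tau> * X h)) \<le> cdf std_normal_distribution (\<tau> + D) + \<eta>"
    using bad by (simp add: measure_gauss_ip_le[OF u])
  have "measure (gauss k) (?P (\<lambda>h. ip k h u \<le> \<tau> - D)) \<le> measure (gauss k) (?P (\<lambda>h. ip k h u \<le> \<tau> * X h) \<union> ?Bad)"
    by (rule gauss.finite_measure_mono) (use close in \<open>fastforce simp: D_def\<close>, measurable)
  also have "\<dots> \<le> measure (gauss k) (?P (\<lambda>h. ip k h u \<le> \<tau> * X h)) + measure (gauss k) ?Bad"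
    by (rule measure_Un_le) measurable
  finally have 2: "cdf std_normal_distribution (\<tau> - D) \<le> measure (gauss k) (?P (\<lambda>h. ip k h u \<le> \<tau> * X h)) + \<eta>"
    using bad by (simp add: measure_gauss_ip_le[OF u])
  have "0 \<le> D" using assms(3) by (simp add: D_def)
  then show ?thesis using 1 2 cl by (simp flip: D_def)
qed

text \<open>The number \<open>b\<close> will be the squared length of the component of \<open>\<^bold>y\<close> orthogonal to \<open>B\<close>.\<close>

lemma gauss_halfspace_estimate:
  assumes B: "orthonormal k B" and k: "k \<ge> 1" and d: "\<delta> > 0" "\<delta> \<le> 1/10" "\<delta> * real k \<ge> 2"
    and eta: "16 / (\<delta>\<^sup>2 * real k) + 2 * real (card B) / (\<delta> * real k) \<le> \<eta>"
    and a: "a = ip k (z - proj k B z) (z - proj k B z)" "1 - \<delta> \<le> a" "a \<le> 1"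
    and b: "1 - \<delta> \<le> b" "b \<le> 1"
  defines "p \<equiv> (\<lambda>h. h - proj k B h)"
  shows "\<bar>measure (gauss k) {h \<in> space (gauss k).
       ip k (p h) z \<le> - (s / (sqrt (real k) * sqrt b)) * sqrt (ip k (p h) (p h))}
       - cdf std_normal_distribution (- s)\<bar> \<le> \<eta> + 4 * \<delta> * \<bar>s\<bar>"
proof -
  have pm [measurable]: "(\<lambda>h. p h i) \<in> borel_measurable (gauss k)" if "i \<le> k" for i
    unfolding p_def proj_def fun_diff_def using that by measurable
  have ab: "a > 0" "b > 0" using a b d by linarith+
  \<comment> \<open>The unit direction of the component of z orthogonal to B. Since p is
    self-adjoint, <p h, z> = sqrt a <h, u> with <h, u> standard normal.\<close>
  define u where "u = (\<lambda>i. inverse (sqrt a) * (z - proj k B z) i)"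
  have "ip k u u = inverse (sqrt a) * (inverse (sqrt a) * ip k (z - proj k B z) (z - proj k B z))"
    unfolding u_def ip_linear ..
  then have uu: "ip k u u = 1" using ab by (simp add: a(1)[symmetric] field_simps)
  have pz: "ip k (p h) z = sqrt a * ip k h u" for h
  proof -
    have "ip k (p h) z = ip k h (z - proj k B z)"
      by (simp add: p_def ip_fun_linear ip_commute[of k h "proj k B z"] ip_proj_left mult.commute)
    then show ?thesis using ab unfolding u_def ip_linear by (simp del: minus_apply)
  qed
  \<comment> \<open>All lengths are collected in one factor near 1: dividing the condition by sqrt a
    turns it into <h, u> <= - s X.\<close>
  define X where "X h = sqrt (ip k (p h) (p h)) / (sqrt (real k) * sqrt b * sqrt a)" for h
  have Xm [measurable]: "X \<in> borel_measurable (gauss k)"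
    unfolding X_def[abs_def] by measurable
  have iff: "ip k (p h) z \<le> - (s / (sqrt (real k) * sqrt b)) * sqrt (ip k (p h) (p h)) \<longleftrightarrow> ip k h u \<le> - s * X h" for h
  proof -
    have eq: "- (s / (sqrt (real k) * sqrt b)) * sqrt (ip k (p h) (p h)) = sqrt a * (- s * X h)"
      using ab by (simp add: X_def)
    show ?thesis unfolding pz eq by (rule mult_le_cancel_left_pos) (use ab in simp)
  qed
  have good: "\<bar>X h - 1\<bar> \<le> 4 * \<delta>"
    if h: "(1 - \<delta>) * real k \<le> ip k (p h) (p h)" "ip k (p h) (p h) \<le> (1 + \<delta>) * real k" for h
  proof -
    have X2: "(X h)\<^sup>2 = ip k (p h) (p h) / real k / (a * b)"
      using ab by (simp add: X_def power_divide power_mult_distrib mult.commute)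
    have X0: "X h \<ge> 0" using ab by (simp add: X_def)
    have k0: "real k > 0" using k by simp
    have q: "1 - \<delta> \<le> ip k (p h) (p h) / real k" "ip k (p h) (p h) / real k \<le> 1 + \<delta>"
      using h k0 by (simp_all add: field_simps)
    have ab1: "(1 - \<delta>) * (1 - \<delta>) \<le> a * b" "a * b \<le> 1"
      using a b d ab by (auto intro: mult_mono mult_le_one)
    have "1 - 4 * \<delta> \<le> 1 - \<delta>" using d by simp
    also have "\<dots> \<le> ip k (p h) (p h) / real k" by (rule q)
    also have "\<dots> \<le> (X h)\<^sup>2"
    proof -
      have "ip k (p h) (p h) / real k * (a * b) \<le> ip k (p h) (p h) / real k * 1"
        using ab1(2) by (intro mult_left_mono) simp_all
      then show ?thesis unfolding X2 by (subst pos_le_divide_eq) (use ab in simp_all)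
    qed
    finally have lower: "1 - 4 * \<delta> \<le> (X h)\<^sup>2" .
    \<comment> \<open>This bounds (1+\<delta>)/(1-\<delta>)^2 by 1 + 4 \<delta>; the range \<delta>
      <= 1/10 makes the remaining factor 1 - 7 \<delta> + 4 \<delta>^2 nonnegative.\<close>
    have "1 + \<delta> \<le> (1 + 4 * \<delta>) * ((1 - \<delta>) * (1 - \<delta>))"
    proof -
      have "(1 + 4 * \<delta>) * ((1 - \<delta>) * (1 - \<delta>)) - (1 + \<delta>) = \<delta> * (1 - 7 * \<delta> + 4 * \<delta>\<^sup>2)"
        by (simp add: algebra_simps power2_eq_square)
      moreover have "1 - 7 * \<delta> + 4 * \<delta>\<^sup>2 \<ge> 0" using d zero_le_power2[of \<delta>] by linarith
      ultimately show ?thesis using d(1) by (smt (verit) mult_nonneg_nonneg)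
    qed
    also have "\<dots> \<le> (1 + 4 * \<delta>) * (a * b)" using ab1(1) d(1) by (intro mult_left_mono) auto
    finally have "ip k (p h) (p h) / real k \<le> (1 + 4 * \<delta>) * (a * b)" using q(2) by linarith
    then have upper: "(X h)\<^sup>2 \<le> 1 + 4 * \<delta>" unfolding X2 by (subst pos_divide_le_eq) (use ab in simp_all)
    \<comment> \<open>As X + 1 >= 1, closeness of X^2 to 1 passes to X without a square root
      estimate.\<close>
    have "\<bar>X h - 1\<bar> \<le> \<bar>X h - 1\<bar> * (X h + 1)" using X0 by (simp add: mult_le_cancel_left1)
    also have "\<dots> = \<bar>(X h)\<^sup>2 - 1\<bar>"
    proof -
      have "(X h)\<^sup>2 - 1 = (X h - 1) * (X h + 1)" by (simp add: power2_eq_square algebra_simps)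
      then show ?thesis using X0 by (simp only: abs_mult)
    qed
    also have "\<dots> \<le> 4 * \<delta>" using lower upper by (simp add: abs_le_iff)
    finally show ?thesis .
  qed
  have "measure (gauss k) {h \<in> space (gauss k). \<not> \<bar>X h - 1\<bar> \<le> 4 * \<delta>}
     \<le> measure (gauss k) {h \<in> space (gauss k). \<not> ((1 - \<delta>) * real k \<le> ip k (p h) (p h) \<and> ip k (p h) (p h) \<le> (1 + \<delta>) * real k)}"
    using good by (intro gauss.finite_measure_mono) (blast, measurable)
  also have "\<dots> \<le> \<eta>"
    using gauss_norm_minus_proj[OF B k d(1,3)] eta unfolding p_def by linarith
  finally have "\<bar>measure (gauss k) {h \<in> space (gauss k). ip k h u \<le> - s * X h} - cdf std_normal_distribution (- s)\<bar>
      \<le> \<eta> + \<bar>- s\<bar> * (4 * \<delta>)"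
    using d(1) by (intro gauss_random_threshold uu Xm) auto
  then show ?thesis unfolding iff by (simp add: mult.commute)
qed

section \<open>Existence of the constants\<close>

abbreviation first_unit :: "nat \<Rightarrow> real" where
  "first_unit \<equiv> \<lambda>i. if i = 0 then 1 else 0"

lemma ip_first_unit [simp]: "ip k x first_unit = x 0" "ip k first_unit x = x 0"
  by (simp_all add: ip_def if_distrib if_distribR cong: if_cong)

lemma measure_gauss_cap:
  assumes "ip k u u = 1"
  shows "emeasure (gauss k) {h \<in> space (gauss k). ip k h u \<le> s * sqrt (ip k h h)}
     = emeasure (gauss k) {h \<in> space (gauss k). h 0 \<le> s * sqrt (ip k h h)}"
proof -
  define T where "T = refl_leb k (u - first_unit)"
  have Tm: "T \<in> measurable (gauss k) (gauss k)"
    unfolding T_def measurable_cong_sets[OF sets_gauss sets_gauss] by measurable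
  have "T h 0 = ip k h u" for h
    unfolding T_def by (rule refl_leb_first[OF assms])
  moreover have "ip k (T h) (T h) = ip k h h" for h
    by (simp add: T_def refl_leb_def ip_reflect_reflect)
  ultimately have "{h \<in> space (gauss k). ip k h u \<le> s * sqrt (ip k h h)}
      = T -` {h \<in> space (gauss k). h 0 \<le> s * sqrt (ip k h h)} \<inter> space (gauss k)"
    using measurable_space[OF Tm] by auto
  also have "emeasure (gauss k) \<dots> = emeasure (distr (gauss k) (gauss k) T) {h \<in> space (gauss k). h 0 \<le> s * sqrt (ip k h h)}"
    by (rule emeasure_distr[OF Tm, symmetric]) measurable
  finally show ?thesis unfolding T_def distr_refl_gauss .
qed

text \<open>The averaging lemma with empty B: the Gaussian probability is then the same for every z,
  so the outer integral over the sphere is trivial.\<close>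

lemma sphere_cap_eq_gauss:
  "measure (sphere_measure k) {x \<in> Sph k. ip k x first_unit \<le> s}
    = measure (gauss k) {h \<in> space (gauss k). h 0 \<le> s * sqrt (ip k h h)}"
proof -
  have B: "orthonormal k {}" by (simp add: orthonormal_def)
  have p0: "proj k {} h = (\<lambda>i. 0)" for h by (simp add: proj_def)
  have "emeasure (sphere_measure k) {z \<in> Sph k. ip k first_unit z \<le> (\<lambda>_. s) z}
    = (\<integral>\<^sup>+z. emeasure (gauss k) {h \<in> space (gauss k). ip k (h - proj k {} h) z \<le> s * sqrt (ip k (h - proj k {} h) (h - proj k {} h))}
         * indicator (Sph k) z \<partial>sphere_measure k)"
    by (rule sphere_gauss_average[OF B])
      (auto simp: reflect_Sph sets_sphere_iff)
  also have "\<dots> = (\<integral>\<^sup>+z. emeasure (gauss k) {h \<in> space (gauss k). h 0 \<le> s * sqrt (ip k h h)} \<partial>sphere_measure k)"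
    by (rule nn_integral_cong) (simp add: p0 fun_diff_def measure_gauss_cap Sph_iff)
  also have "\<dots> = emeasure (gauss k) {h \<in> space (gauss k). h 0 \<le> s * sqrt (ip k h h)}"
    by (simp add: sphere.emeasure_space_1[simplified])
  finally show ?thesis by (simp add: measure_def)
qed

text \<open>Parametrising the level of a cap in this way makes its condition linear in the first coordinate \<open>y\<close>.\<close>

lemma cap_condition:
  fixes y :: real
  assumes "a \<le> 0" "R \<ge> 0"
  shows "y \<le> a / sqrt (1 + a\<^sup>2) * sqrt (y\<^sup>2 + R) \<longleftrightarrow> y \<le> a * sqrt R"
proof -
  have pos: "sqrt (1 + a\<^sup>2) > 0" by (smt (verit) real_sqrt_gt_zero zero_le_power2)
  have "y \<le> a / sqrt (1 + a\<^sup>2) * sqrt (y\<^sup>2 + R) \<longleftrightarrow> y * sqrt (1 + a\<^sup>2) \<le> a * sqrt (y\<^sup>2 + R)"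
    using pos by (simp add: field_simps)
  also have "\<dots> \<longleftrightarrow> y \<le> a * sqrt R"
  proof (cases "y \<le> 0")
    case True
    have "y * sqrt (1 + a\<^sup>2) \<le> a * sqrt (y\<^sup>2 + R) \<longleftrightarrow> (- a) * sqrt (y\<^sup>2 + R) \<le> (- y) * sqrt (1 + a\<^sup>2)"
      by linarith
    also have "\<dots> \<longleftrightarrow> ((- a) * sqrt (y\<^sup>2 + R))\<^sup>2 \<le> ((- y) * sqrt (1 + a\<^sup>2))\<^sup>2"
      using True assms by (intro power_mono_iff[symmetric]) (auto intro: mult_nonpos_nonneg)
    \<comment> \<open>Squaring a comparison of nonnegative numbers; the term a^2 y^2 occurs on both
      sides and cancels.\<close>
    also have "\<dots> \<longleftrightarrow> ((- a) * sqrt R)\<^sup>2 \<le> (- y)\<^sup>2"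
      using assms(2) by (simp add: power_mult_distrib algebra_simps)
    also have "\<dots> \<longleftrightarrow> (- a) * sqrt R \<le> - y"
      using True assms by (intro power_mono_iff) (auto intro: mult_nonpos_nonneg)
    also have "\<dots> \<longleftrightarrow> y \<le> a * sqrt R" by linarith
    finally show ?thesis .
  next
    case False
    have "a * sqrt (y\<^sup>2 + R) \<le> 0" "a * sqrt R \<le> 0"
      using assms by (auto intro!: mult_nonpos_nonneg)
    moreover have "y * sqrt (1 + a\<^sup>2) > 0" using False pos by simp
    ultimately show ?thesis using False by linarith
  qed
  finally show ?thesis .
qed

section \<open>The measure of a cap as a mean over the coordinates other than the first\<close>

definition tail_normal :: "nat \<Rightarrow> (nat \<Rightarrow> real) measure" where
  "tail_normal k = PiM {1..k} (\<lambda>_. std_normal_distribution)"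

definition tail_sq :: "nat \<Rightarrow> (nat \<Rightarrow> real) \<Rightarrow> real" where
  "tail_sq k x = (\<Sum>i\<in>{1..k}. (x i)\<^sup>2)"

text \<open>For a <= 0 this is the measure of the cap at level a / sqrt(1 + a^2), with the first
  coordinate integrated out. In this form continuity and strict monotonicity in a are inherited from
  the normal distribution function.\<close>

definition cap_mean :: "nat \<Rightarrow> real \<Rightarrow> real" where
  "cap_mean k a = (\<integral>x. cdf std_normal_distribution (a * sqrt (tail_sq k x)) \<partial>tail_normal k)"

interpretation tail: prob_space "tail_normal k" for k
  unfolding tail_normal_def by (rule prob_space_PiM) (rule std_normal.prob_space_axioms)

lemma tail_sq_nonneg [simp]: "tail_sq k x \<ge> 0"
  by (simp add: tail_sq_def sum_nonneg)

lemma measurable_tail_component [measurable]: "i \<in> {1..k} \<Longrightarrow> (\<lambda>x. x i) \<in> borel_measurable (tail_normal k)"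
  unfolding tail_normal_def
  by (rule measurable_component_singleton[where M="\<lambda>_. std_normal_distribution", simplified]) simp

lemma measurable_tail_sq [measurable]: "tail_sq k \<in> borel_measurable (tail_normal k)"
  unfolding tail_sq_def[abs_def] by measurable

lemma measurable_cdf_std_normal [measurable]: "cdf std_normal_distribution \<in> borel_measurable borel"
  by (intro borel_measurable_continuous_onI continuous_at_imp_continuous_on ballI isCont_cdf_std_normal)

lemma integrable_cap_mean: "integrable (tail_normal k) (\<lambda>x. cdf std_normal_distribution (a * sqrt (tail_sq k x)))"
  by (rule tail.integrable_const_bound[where B=1])
    (auto simp: std_normal.cdf_nonneg std_normal.cdf_bounded_prob)

lemma AE_tail_sq_pos:
  assumes "k \<ge> 1" shows "AE x in tail_normal k. tail_sq k x > 0"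
proof -
  have d: "distr (tail_normal k) std_normal_distribution (\<lambda>x. x 1) = std_normal_distribution"
    unfolding tail_normal_def using assms by (intro distr_PiM_component std_normal.prob_space_axioms) auto
  have m: "(\<lambda>x. x 1) \<in> measurable (tail_normal k) std_normal_distribution" using assms by simp
  have "AE x in distr (tail_normal k) std_normal_distribution (\<lambda>x. x 1). x \<noteq> 0"
    unfolding d by (rule AE_std_normal_neq)
  then have "AE x in tail_normal k. x 1 \<noteq> 0" by (rule AE_distrD[OF m])
  then show ?thesis
  proof eventually_elim
    case (elim x)
    have "0 < (x 1)\<^sup>2" using elim by simp
    also have "\<dots> \<le> tail_sq k x"
      unfolding tail_sq_def using assms by (intro member_le_sum) auto
    finally show ?case .
  qed
qed

lemma gauss_cap_eq_cap_mean:
  assumes "a \<le> 0"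
  shows "measure (gauss k) {h \<in> space (gauss k). h 0 \<le> a / sqrt (1 + a\<^sup>2) * sqrt (ip k h h)} = cap_mean k a"
proof -
  let ?S = "{h \<in> space (gauss k). h 0 \<le> a / sqrt (1 + a\<^sup>2) * sqrt (ip k h h)}"
  have ins: "insert 0 {1..k} = {..k}" by auto
  have g: "gauss k = PiM (insert 0 {1..k}) (\<lambda>_. std_normal_distribution)"
    unfolding ins gauss_def ..
  have Sm: "?S \<in> sets (gauss k)" by measurable
  have "emeasure (gauss k) ?S = (\<integral>\<^sup>+h. indicator ?S h \<partial>gauss k)" using Sm by simp
  also have "\<dots> = (\<integral>\<^sup>+x. (\<integral>\<^sup>+y. indicator ?S (x(0 := y)) \<partial>std_normal_distribution) \<partial>tail_normal k)"
    unfolding tail_normal_def using Sm unfolding g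
    by (intro normal_prod.product_nn_integral_insert) auto
  also have "\<dots> = (\<integral>\<^sup>+x. ennreal (cdf std_normal_distribution (a * sqrt (tail_sq k x))) \<partial>tail_normal k)"
  proof (rule nn_integral_cong)
    fix x assume x: "x \<in> space (tail_normal k)"
    have "x(0 := y) \<in> ?S \<longleftrightarrow> y \<in> {..a * sqrt (tail_sq k x)}" for y
    proof -
      have "ip k (x(0 := y)) (x(0 := y)) = y\<^sup>2 + tail_sq k x"
        unfolding ip_def ins[symmetric] tail_sq_def
        by (subst sum.insert) (auto simp: power2_eq_square intro!: sum.cong)
      moreover have "x(0 := y) \<in> space (gauss k)"
        using x by (auto simp: g tail_normal_def space_PiM PiE_iff extensional_def)
      ultimately show ?thesis using cap_condition[OF assms tail_sq_nonneg, of y k x] by simp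
    qed
    then have "(\<integral>\<^sup>+y. indicator ?S (x(0 := y)) \<partial>std_normal_distribution)
        = (\<integral>\<^sup>+y. indicator {..a * sqrt (tail_sq k x)} y \<partial>std_normal_distribution)"
      by (intro nn_integral_cong) (simp only: indicator_def)
    then show "(\<integral>\<^sup>+y. indicator ?S (x(0 := y)) \<partial>std_normal_distribution)
        = ennreal (cdf std_normal_distribution (a * sqrt (tail_sq k x)))"
      by (simp add: cdf_def std_normal.emeasure_eq_measure)
  qed
  also have "\<dots> = ennreal (cap_mean k a)"
    unfolding cap_mean_def by (intro nn_integral_eq_integral integrable_cap_mean) (simp add: std_normal.cdf_nonneg)
  finally show ?thesis
    by (simp add: measure_def cap_mean_def integral_nonneg std_normal.cdf_nonneg)
qed

lemma cap_mean_strict_mono: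
  assumes "k \<ge> 1" "a < b" shows "cap_mean k a < cap_mean k b"
  unfolding cap_mean_def
proof (rule tail.integral_less_AE_space[OF integrable_cap_mean integrable_cap_mean])
  show "AE x in tail_normal k. cdf std_normal_distribution (a * sqrt (tail_sq k x))
      < cdf std_normal_distribution (b * sqrt (tail_sq k x))"
    using AE_tail_sq_pos[OF assms(1)]
    by eventually_elim (intro cdf_std_normal_strict_mono mult_strict_right_mono, use assms in auto)
qed (simp add: tail.emeasure_space_1)

lemma cap_mean_0: "cap_mean k 0 = 1 / 2"
  by (simp add: cap_mean_def cdf_std_normal_0 tail.prob_space)

text \<open>Dominated convergence with bound 1. It yields both continuity and the limit 0 at minus
  infinity, where pointwise convergence requires \<open>tail_sq\<close> to be positive.\<close>

lemma tendsto_cap_mean: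
  assumes "\<And>x. tail_sq k x > 0 \<Longrightarrow> (\<lambda>n. cdf std_normal_distribution (X n * sqrt (tail_sq k x))) \<longlonglongrightarrow> f x"
    and [measurable]: "f \<in> borel_measurable (tail_normal k)" and "k \<ge> 1"
  shows "(\<lambda>n. cap_mean k (X n)) \<longlonglongrightarrow> (\<integral>x. f x \<partial>tail_normal k)"
  unfolding cap_mean_def
proof (rule integral_dominated_convergence[where w="\<lambda>_. 1"])
  show "AE x in tail_normal k. (\<lambda>n. cdf std_normal_distribution (X n * sqrt (tail_sq k x))) \<longlonglongrightarrow> f x"
    using AE_tail_sq_pos[OF assms(3)] by eventually_elim (rule assms(1))
qed (auto simp: std_normal.cdf_nonneg std_normal.cdf_bounded_prob)

lemma isCont_cap_mean:
  assumes "k \<ge> 1" shows "isCont (cap_mean k) a"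
  unfolding continuous_at_sequentially o_def
proof safe
  fix X assume "X \<longlonglongrightarrow> a"
  then show "(\<lambda>n. cap_mean k (X n)) \<longlonglongrightarrow> cap_mean k a"
    unfolding cap_mean_def[of k a]
    by (intro tendsto_cap_mean assms isCont_tendsto_compose[OF isCont_cdf_std_normal] tendsto_mult_right) measurable
qed

lemma cap_mean_lim:
  assumes "k \<ge> 1" shows "(\<lambda>n. cap_mean k (- real n)) \<longlonglongrightarrow> 0"
proof -
  have "(\<lambda>n. cap_mean k (- real n)) \<longlonglongrightarrow> (\<integral>x. 0 \<partial>tail_normal k)"
  proof (rule tendsto_cap_mean)
    fix x assume "tail_sq k x > 0"
    then have "filterlim (\<lambda>n. - (sqrt (tail_sq k x) * real n)) at_bot sequentially"
      by (intro filterlim_uminus_at_top[THEN iffD1] filterlim_tendsto_pos_mult_at_top[OF tendsto_const] filterlim_real_sequentially) simp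
    then show "(\<lambda>n. cdf std_normal_distribution (- real n * sqrt (tail_sq k x))) \<longlonglongrightarrow> 0"
      by (intro filterlim_compose[OF std_normal.cdf_lim_at_bot]) (simp add: mult.commute)
  qed (use assms in auto)
  then show ?thesis by simp
qed

lemma sets_sphere_cap: "{x \<in> Sph k. ip k x first_unit \<le> s} \<in> sets (sphere_measure k)"
proof -
  have "{x \<in> space (sphere_measure k). x 0 \<le> s} \<in> sets (sphere_measure k)" by measurable
  then show ?thesis by simp
qed

text \<open>Existence follows from the intermediate value theorem for \<open>cap_mean\<close>, which
  runs from below p up to 1/2 at a = 0. Uniqueness follows from strict monotonicity once every
  competing level is known to have the form a / sqrt(1 + a^2).\<close>

lemma c_const_properties:
  assumes k: "k \<ge> 1" and p: "0 < p" "p < 1/2"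
  shows "0 \<le> c_const k p"
    and "measure (sphere_measure k) {x \<in> Sph k. ip k x first_unit \<le> - c_const k p / sqrt k} = p"
proof -
  define F where "F s = measure (sphere_measure k) {x \<in> Sph k. ip k x first_unit \<le> s}" for s
  have FG: "F (a / sqrt (1 + a\<^sup>2)) = cap_mean k a" if "a \<le> 0" for a
    unfolding F_def sphere_cap_eq_gauss using that by (rule gauss_cap_eq_cap_mean)
  have cm: "{x \<in> Sph k. ip k x first_unit \<le> s} \<in> sets (sphere_measure k)" for s
    by (rule sets_sphere_cap)
  have Fmono: "F s \<le> F t" if "s \<le> t" for s t
    unfolding F_def using that by (intro sphere.finite_measure_mono cm) auto
  have sq: "sqrt (real k) > 0" using k by simp
  obtain n where n: "cap_mean k (- real n) < p"
    using order_tendstoD(2)[OF cap_mean_lim[OF k] p(1)] by (auto simp: eventually_sequentially)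
  obtain a where a: "- real n \<le> a" "a \<le> 0" "cap_mean k a = p"
    using IVT[of "cap_mean k" "- real n" p 0] n p isCont_cap_mean[OF k] by (auto simp: cap_mean_0)
  define c where "c = - a / sqrt (1 + a\<^sup>2) * sqrt (real k)"
  have c: "0 \<le> c \<and> F (- c / sqrt (real k)) = p"
  proof
    show "0 \<le> c" using a(2) unfolding c_def by (intro mult_nonneg_nonneg divide_nonneg_nonneg) auto
    have "- c / sqrt (real k) = a / sqrt (1 + a\<^sup>2)" using sq by (simp add: c_def)
    then show "F (- c / sqrt (real k)) = p" using FG a by simp
  qed
  have uniq: "c' = c" if c': "0 \<le> c' \<and> F (- c' / sqrt (real k)) = p" for c'
  proof -
    define s where "s = - c' / sqrt (real k)"
    have s: "s \<le> 0" "F s = p" using c' sq by (auto simp: s_def divide_nonpos_nonneg)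
    \<comment> \<open>The parametrisation reaches only levels above -1. A level of at most -1 gives
      a cap inside that of parameter - n, whose measure is already below p.\<close>
    have "s > -1"
    proof (rule ccontr)
      assume "\<not> s > -1"
      moreover have "- 1 \<le> - real n / sqrt (1 + (- real n)\<^sup>2)"
        using real_le_rsqrt[of "real n" "1 + (- real n)\<^sup>2"] by (simp add: divide_le_eq add_pos_nonneg)
      ultimately have "F s \<le> F (- real n / sqrt (1 + (- real n)\<^sup>2))" by (intro Fmono) simp
      with FG[of "- real n"] n s(2) show False by simp
    qed
    with s(1) have s1: "1 - s\<^sup>2 > 0" by (simp add: power2_eq_square) (smt (verit) mult_le_cancel_left1 mult_minus_left mult_minus_right)
    \<comment> \<open>The inverse of the parametrisation a / sqrt(1 + a^2).\<close>
    define b where "b = s / sqrt (1 - s\<^sup>2)"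
    have "1 + b\<^sup>2 = inverse (1 - s\<^sup>2)" using s1 by (simp add: b_def power_divide field_simps)
    then have bs: "b / sqrt (1 + b\<^sup>2) = s" using s1 by (simp add: b_def real_sqrt_inverse)
    have "b \<le> 0" using s(1) s1 by (simp add: b_def divide_nonpos_pos)
    with FG[of b] bs s(2) have "cap_mean k b = cap_mean k a" using a by simp
    then have "b = a" using cap_mean_strict_mono[OF k] by (metis linorder_neqE_linordered_idom less_irrefl)
    then show "c' = c" using bs sq by (auto simp: c_def s_def)
  qed
  have "c_const k p = c"
    unfolding c_const_def F_def[symmetric] using c uniq by (rule the_equality)
  then show "0 \<le> c_const k p"
    and "measure (sphere_measure k) {x \<in> Sph k. ip k x first_unit \<le> - c_const k p / sqrt k} = p"
    using c by (simp_all add: F_def)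
qed

section \<open>Existence and uniqueness of p_C\<close>

lemma p_C_properties:
  assumes "C > 1" shows "0 < p_C C" "p_C C < 1/2"
proof -
  \<comment> \<open>The defining equation cleared of its denominator; g is strictly increasing on
    (0,1), so its zero is unique.\<close>
  define g where "g q = ln q - C * ln (1 - q)" for q :: real
  have g_mono: "g a < g b" if "0 < a" "a < b" "b < 1" for a b
  proof -
    have "ln a < ln b" "ln (1 - b) < ln (1 - a)" using that by auto
    then show ?thesis using assms by (simp add: g_def) (smt (verit) mult_less_cancel_left_pos)
  qed
  have iff: "C = ln q / ln (1 - q) \<longleftrightarrow> g q = 0" if "0 < q" "q < 1/2" for q
    using that by (simp add: g_def eq_divide_eq) auto
  \<comment> \<open>A point where g is negative: ln a = -2C, whereas - C ln(1 - a) <= 2aC < 2C. At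
    the other end g(1/2) = (C - 1) ln 2 is positive because C > 1.\<close>
  define a where "a = exp (- 2 * C)"
  have "a < exp (- 2)" using assms by (simp add: a_def)
  also have "exp (- 2 :: real) \<le> 1 / 4"
  proof -
    have "2 \<le> exp (1::real)" using exp_ge_add_one_self[of 1] by simp
    then have "2 * 2 \<le> exp (1::real) * exp 1" by (intro mult_mono) auto
    then show ?thesis by (simp add: exp_minus flip: exp_add) (simp add: field_simps)
  qed
  finally have a: "0 < a" "a < 1/4" by (simp_all add: a_def)
  have "a * a \<le> a * (1/2)" using a by (intro mult_left_mono) auto
  then have "- (2 * a) \<le> ln (1 - a)"
    using ln_one_minus_pos_lower_bound[of a] a unfolding power2_eq_square by linarith
  then have "C * (- (2 * a)) \<le> C * ln (1 - a)" using assms by (intro mult_left_mono) auto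
  moreover have "C * (2 * a) < C * 2" using a assms by simp
  ultimately have ga: "g a < 0" by (simp add: g_def a_def)
  have "g (1/2) = (C - 1) * ln 2" by (simp add: g_def ln_div algebra_simps)
  then have gh: "g (1/2) > 0" using assms by simp
  have "\<exists>q. a \<le> q \<and> q \<le> 1/2 \<and> g q = 0"
    using ga gh a by (intro IVT) (auto simp: g_def intro!: continuous_intros)
  then obtain q where q: "a \<le> q" "q \<le> 1/2" "g q = 0" by blast
  from q(3) gh have "q \<noteq> 1/2" by (metis less_irrefl)
  with q a have q': "0 < q" "q < 1/2" by linarith+
  have "p_C C = q"
    unfolding p_C_def
  proof (rule the_equality)
    show "0 < q \<and> q < 1 / 2 \<and> C = ln q / ln (1 - q)" using q q' iff by simp
    fix r assume r: "0 < r \<and> r < 1 / 2 \<and> C = ln r / ln (1 - r)"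
    then have "g r = 0" using iff[of r] by blast
    then show "r = q" using g_mono[of r q] g_mono[of q r] q q' r by (cases r q rule: linorder_cases) auto
  qed
  then show "0 < p_C C" "p_C C < 1/2" using q' by auto
qed

section \<open>Caps restricted to a set determined by finitely many coordinates\<close>

lemma gauss_cap_estimate:
  assumes k: "k \<ge> 1" and d: "\<delta> > 0" "\<delta> \<le> 1/10" "\<delta> * real k \<ge> 2" and eta: "16 / (\<delta>\<^sup>2 * real k) \<le> \<eta>"
  shows "\<bar>measure (sphere_measure k) {x \<in> Sph k. ip k x first_unit \<le> - s / sqrt (real k)}
     - cdf std_normal_distribution (- s)\<bar> \<le> \<eta> + 4 * \<delta> * \<bar>s\<bar>"
proof -
  have "\<bar>measure (gauss k) {h \<in> space (gauss k). ip k (h - proj k {} h) first_unit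
        \<le> - (s / (sqrt (real k) * sqrt 1)) * sqrt (ip k (h - proj k {} h) (h - proj k {} h))}
     - cdf std_normal_distribution (- s)\<bar> \<le> \<eta> + 4 * \<delta> * \<bar>s\<bar>"
    by (rule gauss_halfspace_estimate[where a=1]) (use assms in \<open>auto simp: orthonormal_def proj_def fun_diff_def\<close>)
  then show ?thesis
    unfolding sphere_cap_eq_gauss by (simp add: proj_def fun_diff_def)
qed

lemma c_const_estimate:
  assumes k: "k \<ge> 1" and d: "\<delta> > 0" "\<delta> \<le> 1/10" "\<delta> * real k \<ge> 2" and eta: "16 / (\<delta>\<^sup>2 * real k) \<le> \<eta>"
    and p: "0 < p" "p < 1/2"
  shows "\<bar>p - cdf std_normal_distribution (- c_const k p)\<bar> \<le> \<eta> + 4 * \<delta> * c_const k p"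
  using gauss_cap_estimate[OF k d eta, of "c_const k p"] c_const_properties[OF k p] by simp

text \<open>A bound on c that can be chosen independently of k: for c > m the cap defining c would
  lie in the cap at m, whose measure is below p.\<close>

lemma c_const_le:
  assumes k: "k \<ge> 1" and d: "\<delta> > 0" "\<delta> \<le> 1/10" "\<delta> * real k \<ge> 2" and eta: "16 / (\<delta>\<^sup>2 * real k) \<le> \<eta>"
    and p: "0 < p" "p < 1/2" and m: "m \<ge> 0" "cdf std_normal_distribution (- m) + \<eta> + 4 * \<delta> * m < p"
  shows "c_const k p \<le> m"
proof (rule ccontr)
  assume "\<not> c_const k p \<le> m"
  then have "- c_const k p / sqrt (real k) \<le> - m / sqrt (real k)" by (intro divide_right_mono) auto
  then have "measure (sphere_measure k) {x \<in> Sph k. ip k x first_unit \<le> - c_const k p / sqrt (real k)}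
     \<le> measure (sphere_measure k) {x \<in> Sph k. ip k x first_unit \<le> - m / sqrt (real k)}"
    by (intro sphere.finite_measure_mono sets_sphere_cap) auto
  also have "\<dots> \<le> cdf std_normal_distribution (- m) + \<eta> + 4 * \<delta> * m"
    using gauss_cap_estimate[OF k d eta, of m] m(1) by (simp add: abs_le_iff)
  finally show False using c_const_properties(2)[OF k p] m(2) by simp
qed

section \<open>Integrals of approximations and expectations under uniform measures\<close>

lemma ennreal_integral_le_nn_integral:
  assumes "integrable M f" shows "ennreal (\<integral>x. f x \<partial>M) \<le> (\<integral>\<^sup>+x. ennreal (f x) \<partial>M)"
proof -
  have "ennreal (\<integral>x. f x \<partial>M) \<le> ennreal (\<integral>x. max 0 (f x) \<partial>M)"
    using assms by (intro ennreal_leI integral_mono) auto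
  also have "\<dots> = (\<integral>\<^sup>+x. ennreal (max 0 (f x)) \<partial>M)"
    using assms by (intro nn_integral_eq_integral[symmetric]) auto
  also have "\<dots> = (\<integral>\<^sup>+x. ennreal (f x) \<partial>M)"
    by (intro nn_integral_cong) (simp add: max_def ennreal_neg)
  finally show ?thesis .
qed

text \<open>\<open>P\<close> enters through its nonnegative integral over A, and both bounds come
  from monotonicity. The lower function f - \<epsilon> may be negative, where truncation only
  increases it; the upper function satisfies f + \<epsilon> >= P >= 0 on A.\<close>

lemma (in finite_measure) measure_between_integrals:
  assumes "ennreal m = (\<integral>\<^sup>+x. ennreal (P x) * indicator A x \<partial>M)" and "m \<ge> 0"
    and f: "integrable M (\<lambda>x. indicator A x * f x)" and A: "A \<in> sets M"
    and P: "\<And>x. x \<in> A \<Longrightarrow> 0 \<le> P x" "\<And>x. x \<in> A \<Longrightarrow> \<bar>P x - f x\<bar> \<le> \<epsilon>"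
  shows "\<bar>m - (\<integral>x. indicator A x * f x \<partial>M)\<bar> \<le> \<epsilon> * measure M A"
proof -
  have iA: "integrable M (\<lambda>x. indicator A x * (f x + e))" "(\<integral>x. indicator A x * (f x + e) \<partial>M)
      = (\<integral>x. indicator A x * f x \<partial>M) + e * measure M A" for e :: real
  proof -
    have i: "integrable M (\<lambda>x. indicator A x * e)" using A
      by (intro integrable_mult_left integrable_real_indicator) (auto simp: less_top[symmetric])
    show "integrable M (\<lambda>x. indicator A x * (f x + e))"
      unfolding distrib_left by (rule Bochner_Integration.integrable_add[OF f i])
    show "(\<integral>x. indicator A x * (f x + e) \<partial>M) = (\<integral>x. indicator A x * f x \<partial>M) + e * measure M A"
      unfolding distrib_left Bochner_Integration.integral_add[OF f i] using A by simp
  qed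
  have "ennreal (\<integral>x. indicator A x * (f x + - \<epsilon>) \<partial>M) \<le> (\<integral>\<^sup>+x. ennreal (indicator A x * (f x + - \<epsilon>)) \<partial>M)"
    by (rule ennreal_integral_le_nn_integral[OF iA(1)])
  also have "\<dots> \<le> ennreal m"
    unfolding assms(1) using P(2) by (intro nn_integral_mono) (force simp: indicator_def abs_le_iff intro: ennreal_leI)
  finally have lower: "(\<integral>x. indicator A x * (f x + - \<epsilon>) \<partial>M) \<le> m"
    using assms(2) by (subst (asm) ennreal_le_iff) auto
  have nn: "0 \<le> indicator A x * (f x + \<epsilon>)" for x
    using P[of x] by (auto simp: indicator_def abs_le_iff)
  have "ennreal m \<le> (\<integral>\<^sup>+x. ennreal (indicator A x * (f x + \<epsilon>)) \<partial>M)"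
    unfolding assms(1) using P(2) by (intro nn_integral_mono) (force simp: indicator_def abs_le_iff intro: ennreal_leI)
  also have "\<dots> = ennreal (\<integral>x. indicator A x * (f x + \<epsilon>) \<partial>M)"
    by (intro nn_integral_eq_integral iA) (use nn in auto)
  finally have upper: "m \<le> (\<integral>x. indicator A x * (f x + \<epsilon>) \<partial>M)"
    using nn by (subst (asm) ennreal_le_iff) (auto intro!: integral_nonneg)
  show ?thesis using lower upper unfolding iA(2) by (simp add: abs_le_iff)
qed

lemma (in finite_measure) integral_uniform_measure:
  fixes g :: "'a \<Rightarrow> real"
  assumes A: "A \<in> sets M" "measure M A > 0" and g: "g \<in> borel_measurable M"
  shows "(\<integral>x. g x \<partial>uniform_measure M A) = (\<integral>x. indicator A x * g x \<partial>M) / measure M A"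
proof -
  have "uniform_measure M A = density M (\<lambda>x. ennreal (indicator A x / measure M A))"
    unfolding uniform_measure_def using A(2)
    by (intro arg_cong[where f="density M"] ext) (auto simp: emeasure_eq_measure indicator_def divide_ennreal[symmetric])
  then show ?thesis
    using A g by (simp add: integral_density)
qed

text \<open>The density is supported on the null set A, so the uniform measure is zero. It fixes the
  value of the expectation when a region of measure 0 is conditioned on.\<close>

lemma (in finite_measure) integral_uniform_measure_null:
  fixes g :: "'a \<Rightarrow> real"
  assumes A: "A \<in> sets M" "measure M A = 0" and g: "g \<in> borel_measurable M"
  shows "(\<integral>x. g x \<partial>uniform_measure M A) = 0"
proof (rule integral_eq_zero_AE)
  have "AE x in M. x \<notin> A"
    using A by (intro AE_not_in) (simp add: null_sets_def emeasure_eq_measure)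
  then show "AE x in uniform_measure M A. g x = 0"
    unfolding uniform_measure_def using A by (subst AE_density) (auto elim!: eventually_mono)
qed

text \<open>Applies the averaging over orthogonal directions to the cap of y: if the Gaussian
  probability for each z in A is nearly affine in <proj y, proj z>, the measure of the cap is nearly
  the integral of that affine function over A.\<close>

lemma cap_fraction:
  assumes B: "orthonormal k B" and k: "k \<ge> 1"
    and A: "A \<in> sets (sphere_measure k)"
    and inv: "\<And>w z. \<lbrakk>z \<in> Sph k; \<And>i. i > k \<Longrightarrow> w i = 0; \<And>b. b \<in> B \<Longrightarrow> ip k w b = 0\<rbrakk>
        \<Longrightarrow> reflect k w z \<in> A \<longleftrightarrow> z \<in> A"
    and y: "y \<in> Sph k" and b: "b = ip k (y - proj k B y) (y - proj k B y)" "b > 0"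
    and bnd: "\<And>z. z \<in> A \<Longrightarrow> \<bar>ip k (proj k B y) (proj k B z)\<bar> \<le> 1"
    and P: "\<And>z. z \<in> A \<Longrightarrow> \<bar>measure (gauss k) {h \<in> space (gauss k). ip k (h - proj k B h) z
        \<le> - ((c + sqrt (real k) * ip k (proj k B y) (proj k B z)) / (sqrt (real k) * sqrt b))
           * sqrt (ip k (h - proj k B h) (h - proj k B h))}
      - (p - (sqrt (real k) * ip k (proj k B y) (proj k B z)) * \<phi>)\<bar> \<le> \<epsilon>"
  shows "\<bar>measure (sphere_measure k) {z \<in> A. ip k y z \<le> - c / sqrt (real k)}
     - (p * measure (sphere_measure k) A
        - sqrt (real k) * \<phi> * (\<integral>z. indicator A z * ip k (proj k B y) (proj k B z) \<partial>sphere_measure k))\<bar>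
     \<le> \<epsilon> * measure (sphere_measure k) A"
proof -
  define e where "e = (\<lambda>i. inverse (sqrt b) * (y - proj k B y) i)"
  define \<theta> where "\<theta> z = - ((c + sqrt (real k) * ip k (proj k B y) (proj k B z)) / (sqrt (real k) * sqrt b))" for z
  have fin: "finite B" and Bv: "\<And>b i. b \<in> B \<Longrightarrow> i > k \<Longrightarrow> b i = 0" using B by (auto simp: orthonormal_def)
  have projm: "(\<lambda>z. ip k (proj k B y) (proj k B z)) \<in> borel_measurable (sphere_measure k)"
    unfolding ip_proj_proj[OF B] by measurable
  have meas: "\<theta> \<in> borel_measurable (sphere_measure k)"
    unfolding \<theta>_def[abs_def] using projm by measurable
  have ipe: "ip k e z = inverse (sqrt b) * ip k (y - proj k B y) z" for z
    unfolding e_def by (rule ip_linear(3))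
  have "ip k e e = inverse (sqrt b) * (inverse (sqrt b) * ip k (y - proj k B y) (y - proj k B y))"
    unfolding e_def ip_linear ..
  then have ee: "ip k e e = 1" using b(2) by (simp add: b(1)[symmetric] field_simps)
  have ev: "e i = 0" if "i > k" for i
  proof -
    have "proj k B y i = 0" unfolding proj_def using that Bv by (intro sum.neutral) auto
    then show ?thesis using y that by (simp add: e_def Sph_iff)
  qed
  have eb: "ip k e b' = 0" if "b' \<in> B" for b'
    unfolding ipe ip_fun_linear ip_proj_basis[OF B that] by simp
  have inv': "(reflect k w z \<in> A \<longleftrightarrow> z \<in> A) \<and> \<theta> (reflect k w z) = \<theta> z"
    if "z \<in> Sph k" "\<And>i. i > k \<Longrightarrow> w i = 0" "\<And>b. b \<in> B \<Longrightarrow> ip k w b = 0" for w z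
  proof -
    have "proj k B (reflect k w z) = proj k B z"
      unfolding proj_def ip_reflect_left using that(3) by (auto intro!: sum.cong)
    then show ?thesis using inv[OF that] by (simp add: \<theta>_def)
  qed
  \<comment> \<open>Split y into its projection and sqrt b times the unit vector e: the cap
    condition becomes one on <e, z>, with a threshold \<theta> depending on z only through its
    projection.\<close>
  have iff: "ip k y z \<le> - c / sqrt (real k) \<longleftrightarrow> ip k e z \<le> \<theta> z" for z
  proof -
    have pos: "sqrt b > 0" "sqrt (real k) > 0" using b(2) k by auto
    have yz: "ip k y z = ip k (y - proj k B y) z + ip k (proj k B y) (proj k B z)"
      unfolding ip_proj_proj[OF B] by (simp add: ip_fun_linear ip_proj_left)
    have th: "\<theta> z = inverse (sqrt b) * (- c / sqrt (real k) - ip k (proj k B y) (proj k B z))"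
      using pos by (simp add: \<theta>_def field_simps)
    have "ip k e z \<le> \<theta> z \<longleftrightarrow> ip k (y - proj k B y) z \<le> - c / sqrt (real k) - ip k (proj k B y) (proj k B z)"
      unfolding ipe th by (rule mult_le_cancel_left_pos) (use pos in simp)
    then show ?thesis unfolding yz by linarith
  qed
  have f: "integrable (sphere_measure k) (\<lambda>z. indicator A z * (p - (sqrt (real k) * ip k (proj k B y) (proj k B z)) * \<phi>))"
  proof (rule sphere.integrable_const_bound[where B="\<bar>p\<bar> + sqrt (real k) * \<bar>\<phi>\<bar>"])
    show "AE z in sphere_measure k. norm (indicator A z * (p - (sqrt (real k) * ip k (proj k B y) (proj k B z)) * \<phi>)) \<le> \<bar>p\<bar> + sqrt (real k) * \<bar>\<phi>\<bar>"
    proof (rule AE_I2)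
      fix z
      show "norm (indicator A z * (p - (sqrt (real k) * ip k (proj k B y) (proj k B z)) * \<phi>)) \<le> \<bar>p\<bar> + sqrt (real k) * \<bar>\<phi>\<bar>"
      proof (cases "z \<in> A")
        case True
        have "\<bar>p - (sqrt (real k) * ip k (proj k B y) (proj k B z)) * \<phi>\<bar>
          \<le> \<bar>p\<bar> + sqrt (real k) * \<bar>ip k (proj k B y) (proj k B z)\<bar> * \<bar>\<phi>\<bar>"
          using abs_triangle_ineq4[of p "(sqrt (real k) * ip k (proj k B y) (proj k B z)) * \<phi>"] by (simp add: abs_mult)
        also have "\<dots> \<le> \<bar>p\<bar> + sqrt (real k) * 1 * \<bar>\<phi>\<bar>"
          using bnd[OF True] by (intro add_left_mono mult_right_mono mult_left_mono) auto
        finally show ?thesis using True by simp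
      qed simp
    qed
  qed (use projm A in measurable)
  have g: "integrable (sphere_measure k) (\<lambda>z. indicator A z * ip k (proj k B y) (proj k B z))"
    using projm A bnd by (intro sphere.integrable_const_bound[where B=1] AE_I2) (auto simp: indicator_def)
  have m: "ennreal (measure (sphere_measure k) {z \<in> A. ip k y z \<le> - c / sqrt (real k)})
    = (\<integral>\<^sup>+z. ennreal (measure (gauss k) {h \<in> space (gauss k). ip k (h - proj k B h) z \<le> \<theta> z
           * sqrt (ip k (h - proj k B h) (h - proj k B h))}) * indicator A z \<partial>sphere_measure k)"
    unfolding sphere.emeasure_eq_measure[symmetric] gauss.emeasure_eq_measure[symmetric] iff
    by (rule sphere_gauss_average[OF B A meas inv' ee ev eb])
  have "\<bar>measure (sphere_measure k) {z \<in> A. ip k y z \<le> - c / sqrt (real k)}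
      - (\<integral>z. indicator A z * (p - (sqrt (real k) * ip k (proj k B y) (proj k B z)) * \<phi>) \<partial>sphere_measure k)\<bar>
     \<le> \<epsilon> * measure (sphere_measure k) A"
    using P by (intro sphere.measure_between_integrals[OF m _ f A]) (auto simp: \<theta>_def)
  also have "(\<integral>z. indicator A z * (p - (sqrt (real k) * ip k (proj k B y) (proj k B z)) * \<phi>) \<partial>sphere_measure k)
     = (\<integral>z. p * indicator A z - sqrt (real k) * \<phi> * (indicator A z * ip k (proj k B y) (proj k B z)) \<partial>sphere_measure k)"
    by (intro Bochner_Integration.integral_cong) (auto simp: algebra_simps)
  also have "\<dots> = p * measure (sphere_measure k) A
        - sqrt (real k) * \<phi> * (\<integral>z. indicator A z * ip k (proj k B y) (proj k B z) \<partial>sphere_measure k)"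
  proof -
    have "integrable (sphere_measure k) (\<lambda>z. p * indicator A z)"
      using A by (intro integrable_mult_right integrable_real_indicator) (auto simp: less_top[symmetric])
    moreover have "A \<inter> Sph k = A" using A by (auto simp: sets_sphere_iff)
    ultimately show ?thesis
      using g A by (subst Bochner_Integration.integral_diff) auto
  qed
  finally show ?thesis .
qed

section \<open>Perfect sequences and the regions they define\<close>

lemma perfect_append:
  assumes "xs \<noteq> []"
  shows "perfect C l k (xs @ [z]) \<longleftrightarrow> perfect C l k xs \<and> z \<in> Sph k \<and>
     L2_set (orth_proj k xs z) {..k} \<le> alpha_C C * sqrt l / sqrt k"
proof -
  have "(\<forall>i. 1 \<le> i \<and> i < length (xs @ [z]) \<longrightarrow>
      L2_set (orth_proj k (take i (xs @ [z])) ((xs @ [z]) ! i)) {..k} \<le> alpha_C C * sqrt l / sqrt k)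
    \<longleftrightarrow> (\<forall>i. 1 \<le> i \<and> i < length xs \<longrightarrow> L2_set (orth_proj k (take i xs) (xs ! i)) {..k} \<le> alpha_C C * sqrt l / sqrt k)
      \<and> L2_set (orth_proj k xs z) {..k} \<le> alpha_C C * sqrt l / sqrt k" (is "?L \<longleftrightarrow> ?R")
  proof
    assume L: ?L
    show ?R
    proof safe
      fix i assume "1 \<le> i" "i < length xs"
      then show "L2_set (orth_proj k (take i xs) (xs ! i)) {..k} \<le> alpha_C C * sqrt l / sqrt k"
        using L[rule_format, of i] by (simp add: nth_append)
    next
      show "L2_set (orth_proj k xs z) {..k} \<le> alpha_C C * sqrt l / sqrt k"
        using L[rule_format, of "length xs"] assms by (simp add: Suc_le_eq)
    qed
  next
    assume R: ?R
    show ?L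
    proof safe
      fix i assume i: "1 \<le> i" "i < length (xs @ [z])"
      show "L2_set (orth_proj k (take i (xs @ [z])) ((xs @ [z]) ! i)) {..k} \<le> alpha_C C * sqrt l / sqrt k"
      proof (cases "i < length xs")
        case True
        then show ?thesis using R i by (simp add: nth_append)
      next
        case False
        then have "i = length xs" using i by simp
        then show ?thesis using R by simp
      qed
    qed
  qed
  then show ?thesis using assms unfolding perfect_def by auto
qed

text \<open>Treats both kinds of neighbourhood at once: \<open>Q\<close> is either the bound v <= -
  c / sqrt k on the inner product or its negation.\<close>

definition per_region :: "real \<Rightarrow> nat \<Rightarrow> nat \<Rightarrow> (real \<Rightarrow> bool) \<Rightarrow> (nat \<Rightarrow> real) list \<Rightarrow> (nat \<Rightarrow> real) set" where
  "per_region C l k Q xs = {z \<in> Sph k. (\<forall>x\<in>set xs. Q (ip k x z)) \<and> perfect C l k (xs @ [z])}"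

lemma perfect_in_Sph: "perfect C l k (xs @ [z]) \<Longrightarrow> z \<in> Sph k"
  by (simp add: perfect_def)

lemma N_per_eq: "xs \<noteq> [] \<Longrightarrow> N_per C l k p xs = per_region C l k (\<lambda>v. v \<le> - c_const k p / sqrt k) xs"
  by (auto simp: N_per_def per_region_def nbhd_def dest: perfect_in_Sph)

lemma co_N_per_eq: "xs \<noteq> [] \<Longrightarrow> co_N_per C l k p xs = per_region C l k (\<lambda>v. \<not> v \<le> - c_const k p / sqrt k) xs"
  by (auto simp: co_N_per_def per_region_def co_nbhd_def nbhd_def dest: perfect_in_Sph)

text \<open>Projecting onto the larger span can only lengthen the projection of z, so z remains
  perfect when y is dropped. In general this is only an inclusion.\<close>

lemma per_region_append_subset:
  assumes "xs \<noteq> []" "perfect C l k (xs @ [y])"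
  shows "per_region C l k Q (xs @ [y]) \<subseteq> {z \<in> per_region C l k Q xs. Q (ip k y z)}"
proof
  fix z assume z: "z \<in> per_region C l k Q (xs @ [y])"
  have v: "\<forall>i>k. x i = 0" if "x \<in> set (xs @ [y])" for x
    using assms(2) that by (auto simp: perfect_def Sph_iff)
  have "L2_set (orth_proj k xs z) {..k} \<le> L2_set (orth_proj k (xs @ [y]) z) {..k}"
    by (rule norm_orth_proj_mono[OF v]) auto
  moreover have "L2_set (orth_proj k (xs @ [y]) z) {..k} \<le> alpha_C C * sqrt l / sqrt k" "z \<in> Sph k"
    using z perfect_append[of "xs @ [y]" C l k z] by (auto simp: per_region_def)
  ultimately have "perfect C l k (xs @ [z])"
    using assms perfect_append[OF assms(1)] by auto
  then show "z \<in> {z \<in> per_region C l k Q xs. Q (ip k y z)}"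
    using z by (auto simp: per_region_def)
qed

text \<open>The two-sided estimate behind both inequalities, with the cap of y taken in either kind
  of region. The third claim covers null regions, where the ratio is a division by zero.\<close>

lemma per_region_fraction:
  fixes l k :: nat
  assumes xs: "xs \<noteq> []" and perf: "perfect C l k (xs @ [y])"
    and Q: "{v. Q v} \<in> sets borel"
    and k: "k \<ge> 1" and d: "\<delta> > 0" "\<delta> \<le> 1/10" "\<delta> * real k \<ge> 2"
    and eta: "16 / (\<delta>\<^sup>2 * real k) + 2 * real (length xs) / (\<delta> * real k) \<le> \<eta>"
    and alpha: "(alpha_C C)\<^sup>2 * real l / real k \<le> \<delta>" "(alpha_C C)\<^sup>2 * real l / sqrt (real k) \<le> \<tau>" "\<tau> \<le> 1"
    and p: "0 < p" "p < 1/2"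
  defines "c \<equiv> c_const k p"
  defines "\<epsilon> \<equiv> 2 * \<eta> + 4 * \<delta> * (2 * c + 1) + \<tau>\<^sup>2"
  defines "A \<equiv> per_region C l k Q xs"
  defines "\<mu> \<equiv> measure (sphere_measure k)"
  shows "A \<in> sets (sphere_measure k)"
    and "\<mu> A > 0 \<Longrightarrow> \<bar>\<mu> {z \<in> A. ip k y z \<le> - c / sqrt k} / \<mu> A
        - (p - sqrt (real k / (2 * pi)) * exp (- c\<^sup>2 / 2) * E_proj k A xs y)\<bar> \<le> \<epsilon>"
    and "\<mu> A = 0 \<Longrightarrow> E_proj k A xs y = 0"
proof -
  have xsS: "x \<in> Sph k" if "x \<in> set xs" for x using perf that by (auto simp: perfect_def)
  then have xv: "\<forall>i>k. x i = 0" if "x \<in> set xs" for x using that by (auto simp: Sph_iff)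
  obtain B where B: "orthonormal k B" "card B \<le> length xs" "vec_span B = vec_span (set xs)"
    using orthonormal_spanning[OF xv] by blast
  have fin: "finite B" using B(1) by (simp add: orthonormal_def)
  have op: "orth_proj k xs v = proj k B v" for v by (rule orth_proj_eq_proj[OF xv B(1,3)])
  define r where "r = alpha_C C * sqrt l / sqrt k"
  have r2: "r\<^sup>2 = (alpha_C C)\<^sup>2 * real l / real k"
    by (simp add: r_def power_divide power_mult_distrib)
  have Aeq: "A = {z \<in> Sph k. (\<forall>x\<in>set xs. Q (ip k x z)) \<and> sqrt (ip k (proj k B z) (proj k B z)) \<le> r}"
    using perf unfolding A_def per_region_def perfect_append[OF xs] op L2_set_ip r_def by auto
  have yS: "y \<in> Sph k" "sqrt (ip k (proj k B y) (proj k B y)) \<le> r"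
    using perf unfolding perfect_append[OF xs] op L2_set_ip r_def by auto
  have r0: "r \<ge> 0" using yS(2) by (rule order_trans[rotated]) simp
  have projm: "(\<lambda>z. ip k (proj k B y) (proj k B z)) \<in> borel_measurable (sphere_measure k)"
    "(\<lambda>z. ip k (proj k B z) (proj k B z)) \<in> borel_measurable (sphere_measure k)"
    unfolding ip_proj_proj[OF B(1)] by measurable
  have Qm: "{z \<in> space (sphere_measure k). Q (ip k x z)} \<in> sets (sphere_measure k)" for x
    using measurable_sets[OF measurable_sphere_ip Q, of k x] by (simp add: vimage_def Int_def conj_commute)
  show A: "A \<in> sets (sphere_measure k)"
  proof -
    have "A = {z \<in> {z \<in> space (sphere_measure k). \<forall>x\<in>set xs. Q (ip k x z)}. sqrt (ip k (proj k B z) (proj k B z)) \<le> r}"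
      unfolding Aeq by auto
    also have "\<dots> \<in> sets (sphere_measure k)"
    proof (rule sets_Collect_in)
      show "{z \<in> space (sphere_measure k). \<forall>x\<in>set xs. Q (ip k x z)} \<in> sets (sphere_measure k)"
        by (rule sets.sets_Collect_finite_All[OF Qm]) simp
      show "{z \<in> space (sphere_measure k). sqrt (ip k (proj k B z) (proj k B z)) \<le> r} \<in> sets (sphere_measure k)"
        using projm(2) by measurable
    qed
    finally show ?thesis .
  qed
  have E0: "E_proj k A xs y = (\<integral>z. ip k (proj k B y) (proj k B z) \<partial>uniform_measure (sphere_measure k) A)"
    by (simp add: E_proj_def op)
  show "E_proj k A xs y = 0" if "\<mu> A = 0"
    unfolding E0 using that A projm(1) by (intro sphere.integral_uniform_measure_null) (simp_all add: \<mu>_def)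
  have norm_proj: "ip k (proj k B z) (proj k B z) \<le> r\<^sup>2" "ip k (z - proj k B z) (z - proj k B z) = 1 - ip k (proj k B z) (proj k B z)"
    if "z \<in> Sph k" "sqrt (ip k (proj k B z) (proj k B z)) \<le> r" for z
  proof -
    show "ip k (proj k B z) (proj k B z) \<le> r\<^sup>2" using that(2) by (rule sqrt_le_D)
    have "ip k (z - proj k B z) (z - proj k B z) = ip k z z - 2 * ip k (proj k B z) z + ip k (proj k B z) (proj k B z)"
      unfolding ip_fun_linear ip_commute[of k z "proj k B z"] by simp
    also have "ip k (proj k B z) z = ip k (proj k B z) (proj k B z)"
      unfolding ip_proj_proj[OF B(1)] unfolding ip_proj_left ..
    finally show "ip k (z - proj k B z) (z - proj k B z) = 1 - ip k (proj k B z) (proj k B z)"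
      using that(1) by (simp add: Sph_iff del: minus_apply)
  qed
  define b where "b = ip k (y - proj k B y) (y - proj k B y)"
  have b: "1 - \<delta> \<le> b" "b \<le> 1" "b > 0"
    using norm_proj[OF yS] alpha(1) d(2) ip_self_nonneg[of k "proj k B y"] unfolding b_def r2 by auto
  define t where "t z = sqrt (real k) * ip k (proj k B y) (proj k B z)" for z
  have ip_r2: "\<bar>ip k (proj k B y) (proj k B z)\<bar> \<le> r\<^sup>2" if "z \<in> A" for z
  proof -
    have "\<bar>ip k (proj k B y) (proj k B z)\<bar> \<le> sqrt (ip k (proj k B y) (proj k B y)) * sqrt (ip k (proj k B z) (proj k B z))"
      by (rule ip_Cauchy_Schwarz)
    also have "\<dots> \<le> r * r" using yS(2) that r0 by (intro mult_mono) (auto simp: Aeq)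
    finally show ?thesis by (simp add: power2_eq_square)
  qed
  \<comment> \<open>Both projections have length at most r, so |t| <= sqrt k r^2; for sqrt k = D l
    this is \<alpha>^2 / D.\<close>
  have tz: "\<bar>t z\<bar> \<le> \<tau>" if "z \<in> A" for z
  proof -
    have "\<bar>t z\<bar> \<le> sqrt (real k) * r\<^sup>2"
      using ip_r2[OF that] by (simp add: t_def abs_mult mult_left_mono)
    also have "\<dots> = (alpha_C C)\<^sup>2 * real l / sqrt (real k)"
      unfolding r2 using k by (simp add: real_div_sqrt field_simps)
    finally show ?thesis using alpha(2) by linarith
  qed
  have c0: "c \<ge> 0" unfolding c_def by (rule c_const_properties[OF k p])
  have eta1: "16 / (\<delta>\<^sup>2 * real k) \<le> \<eta>"
    using eta d(1) k by (smt (verit) divide_nonneg_nonneg mult_nonneg_nonneg of_nat_0_le_iff)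
  have eta2: "16 / (\<delta>\<^sup>2 * real k) + 2 * real (card B) / (\<delta> * real k) \<le> \<eta>"
  proof -
    have "2 * real (card B) / (\<delta> * real k) \<le> 2 * real (length xs) / (\<delta> * real k)"
      using B(2) d(1) by (intro divide_right_mono) auto
    then show ?thesis using eta by linarith
  qed
  have pc: "\<bar>p - cdf std_normal_distribution (- c)\<bar> \<le> \<eta> + 4 * \<delta> * c"
    unfolding c_def by (rule c_const_estimate[OF k d eta1 p])
  have P: "\<bar>measure (gauss k) {h \<in> space (gauss k). ip k (h - proj k B h) z
        \<le> - ((c + t z) / (sqrt (real k) * sqrt b)) * sqrt (ip k (h - proj k B h) (h - proj k B h))}
      - (p - t z * std_normal_density c)\<bar> \<le> \<epsilon>" if z: "z \<in> A" for z
  proof -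
    have zS: "z \<in> Sph k" "sqrt (ip k (proj k B z) (proj k B z)) \<le> r" using z by (auto simp: Aeq)
    have a: "1 - \<delta> \<le> ip k (z - proj k B z) (z - proj k B z)" "ip k (z - proj k B z) (z - proj k B z) \<le> 1"
      using norm_proj[OF zS] alpha(1) ip_self_nonneg[of k "proj k B z"] unfolding r2 by auto
    have 1: "\<bar>measure (gauss k) {h \<in> space (gauss k). ip k (h - proj k B h) z
        \<le> - ((c + t z) / (sqrt (real k) * sqrt b)) * sqrt (ip k (h - proj k B h) (h - proj k B h))}
       - cdf std_normal_distribution (- (c + t z))\<bar> \<le> \<eta> + 4 * \<delta> * \<bar>c + t z\<bar>"
      by (rule gauss_halfspace_estimate[OF B(1) k d eta2 refl a b(1,2)])
    have 2: "4 * \<delta> * \<bar>c + t z\<bar> \<le> 4 * \<delta> * (c + 1)"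
      using d(1) tz[OF z] alpha(3) c0 by (intro mult_left_mono) (auto simp: abs_le_iff)
    have 3: "\<bar>cdf std_normal_distribution (- c + - t z) - cdf std_normal_distribution (- c) - (- t z) * std_normal_density (- c)\<bar> \<le> (- t z)\<^sup>2"
      by (rule cdf_std_normal_taylor)
    have 4: "std_normal_density (- c) = std_normal_density c" by (simp add: std_normal_density_def)
    have 5: "(- t z)\<^sup>2 \<le> \<tau>\<^sup>2" using tz[OF z] by (simp add: power2_le_iff_abs_le)
    have 6: "- (c + t z) = - c + - t z" by simp
    \<comment> \<open>The error budget: \<eta> + 4 \<delta> (c+1) for replacing the Gaussian
      probability by \<Phi>(-c-t), \<eta> + 4 \<delta> c for replacing \<Phi>(-c) by p, and \<tau>^2
      for the Taylor remainder.\<close>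
    have 7: "\<epsilon> = 2 * \<eta> + 4 * \<delta> * (c + 1) + 4 * \<delta> * c + \<tau>\<^sup>2" by (simp add: \<epsilon>_def algebra_simps)
    show ?thesis using 1 2 3 5 pc unfolding 4 6 7 by (simp only: abs_le_iff) linarith
  qed
  assume pos: "\<mu> A > 0"
  \<comment> \<open>A reflection vector orthogonal to B is orthogonal to every x in the list, since
    these lie in the span of B. So all data defining A are preserved.\<close>
  have inv: "reflect k w z \<in> A \<longleftrightarrow> z \<in> A"
    if "z \<in> Sph k" "\<And>i. i > k \<Longrightarrow> w i = 0" and wB: "\<And>b. b \<in> B \<Longrightarrow> ip k w b = 0" for w z
  proof -
    have "proj k B (reflect k w z) = proj k B z"
      unfolding proj_def ip_reflect_left using wB by (auto intro!: sum.cong)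
    moreover have "ip k x (reflect k w z) = ip k x z" if "x \<in> set xs" for x
    proof -
      have "x \<in> vec_span B" using that B(3) by (simp add: fun_vec.span_base)
      then have "ip k w x = 0" by (rule ip_span_eq_0[rotated]) (rule wB)
      then show ?thesis by (simp add: ip_reflect_right ip_commute[of k x w])
    qed
    ultimately show ?thesis using reflect_Sph[OF that(2)] by (auto simp: Aeq)
  qed
  have "r\<^sup>2 \<le> 1" using alpha(1) d(2) unfolding r2 by linarith
  then have bnd: "\<bar>ip k (proj k B y) (proj k B z)\<bar> \<le> 1" if "z \<in> A" for z
    using ip_r2[OF that] by linarith
  define J where "J = (\<integral>z. indicator A z * ip k (proj k B y) (proj k B z) \<partial>sphere_measure k)"
  have main: "\<bar>\<mu> {z \<in> A. ip k y z \<le> - c / sqrt k} - (p * \<mu> A - sqrt (real k) * std_normal_density c * J)\<bar> \<le> \<epsilon> * \<mu> A"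
    unfolding \<mu>_def J_def
    by (rule cap_fraction[OF B(1) k A inv yS(1) b_def b(3) bnd P[unfolded t_def]])
  have EJ: "E_proj k A xs y = J / \<mu> A"
    unfolding E0 J_def \<mu>_def using pos A projm(1) by (intro sphere.integral_uniform_measure) (simp_all add: \<mu>_def)
  have phi: "sqrt (real k / (2 * pi)) * exp (- c\<^sup>2 / 2) = sqrt (real k) * std_normal_density c"
    by (simp add: std_normal_density_def real_sqrt_divide)
  have "\<bar>\<mu> {z \<in> A. ip k y z \<le> - c / sqrt k} / \<mu> A - (p - sqrt (real k) * std_normal_density c * (J / \<mu> A))\<bar>
      = \<bar>\<mu> {z \<in> A. ip k y z \<le> - c / sqrt k} - (p * \<mu> A - sqrt (real k) * std_normal_density c * J)\<bar> / \<mu> A"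
  proof -
    have "\<mu> {z \<in> A. ip k y z \<le> - c / sqrt k} / \<mu> A - (p - sqrt (real k) * std_normal_density c * (J / \<mu> A))
       = (\<mu> {z \<in> A. ip k y z \<le> - c / sqrt k} - (p * \<mu> A - sqrt (real k) * std_normal_density c * J)) / \<mu> A"
      using pos by (simp add: field_simps)
    then show ?thesis using pos by (simp only: abs_divide abs_of_pos)
  qed
  also have "\<dots> \<le> \<epsilon>" using main pos by (simp add: divide_le_eq)
  finally show "\<bar>\<mu> {z \<in> A. ip k y z \<le> - c / sqrt k} / \<mu> A
        - (p - sqrt (real k / (2 * pi)) * exp (- c\<^sup>2 / 2) * E_proj k A xs y)\<bar> \<le> \<epsilon>"
    unfolding phi EJ .
qed

text \<open>The numerator is included in the cap of y inside the region for \<open>Q_ratio\<close>,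
  and in its complement inside the region for \<open>co_Q_ratio\<close>. Taking complements changes
  p to 1 - p and reverses the sign of the linear term.\<close>

lemma Q_ratio_bounds:
  fixes l k :: nat
  assumes xs: "xs \<noteq> []" and perf: "perfect C l k (xs @ [y])"
    and k: "k \<ge> 1" and d: "\<delta> > 0" "\<delta> \<le> 1/10" "\<delta> * real k \<ge> 2"
    and eta: "16 / (\<delta>\<^sup>2 * real k) + 2 * real (length xs) / (\<delta> * real k) \<le> \<eta>"
    and alpha: "(alpha_C C)\<^sup>2 * real l / real k \<le> \<delta>" "(alpha_C C)\<^sup>2 * real l / sqrt (real k) \<le> \<tau>" "\<tau> \<le> 1"
    and p: "0 < p" "p < 1/2"
  defines "\<epsilon> \<equiv> 2 * \<eta> + 4 * \<delta> * (2 * c_const k p + 1) + \<tau>\<^sup>2"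
  shows "Q_ratio C l k p xs y
      \<le> p - sqrt (real k / (2 * pi)) * exp (- (c_const k p)\<^sup>2 / 2) * E_proj k (N_per C l k p xs) xs y + \<epsilon>" (is ?Q)
    and "co_Q_ratio C l k p xs y
      \<le> 1 - p + sqrt (real k / (2 * pi)) * exp (- (c_const k p)\<^sup>2 / 2) * E_proj k (co_N_per C l k p xs) xs y + \<epsilon>" (is ?coQ)
proof -
  define c where "c = c_const k p"
  define \<mu> where "\<mu> = measure (sphere_measure k)"
  have "\<eta> \<ge> 0" by (rule order_trans[OF _ eta]) (use d(1) in simp)
  moreover have "c_const k p \<ge> 0" by (rule c_const_properties[OF k p])
  ultimately have e0: "\<epsilon> \<ge> 0" using d(1) by (simp add: \<epsilon>_def)
  have xs': "xs @ [y] \<noteq> []" by simp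
  have ipm: "{z \<in> A. ip k y z \<le> s} \<in> sets (sphere_measure k)" if "A \<in> sets (sphere_measure k)" for A s
    by (rule sets_Collect_in[OF that]) measurable
  show ?Q
  proof -
    let ?R = "\<lambda>v. v \<le> - c / sqrt k"
    define A where "A = per_region C l k ?R xs"
    have "{v. ?R v} \<in> sets borel" by simp
    note F = per_region_fraction[OF xs perf this k d eta alpha p, folded c_def, folded A_def \<mu>_def]
    have sub: "per_region C l k ?R (xs @ [y]) \<subseteq> {z \<in> A. ip k y z \<le> - c / sqrt k}"
      unfolding A_def by (rule per_region_append_subset[OF xs perf])
    have Q: "Q_ratio C l k p xs y = \<mu> (per_region C l k ?R (xs @ [y])) / \<mu> A"
      by (simp add: Q_ratio_def P_per_def N_per_eq[OF xs] N_per_eq[OF xs'] A_def \<mu>_def c_def)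
    show ?thesis
      unfolding N_per_eq[OF xs] Q c_def[symmetric] A_def[symmetric]
    proof (cases "\<mu> A > 0")
      case True
      have "\<mu> (per_region C l k ?R (xs @ [y])) / \<mu> A \<le> \<mu> {z \<in> A. ip k y z \<le> - c / sqrt k} / \<mu> A"
        using True unfolding \<mu>_def by (intro divide_right_mono sphere.finite_measure_mono sub ipm F(1)) auto
      then show "\<mu> (per_region C l k ?R (xs @ [y])) / \<mu> A
          \<le> p - sqrt (real k / (2 * pi)) * exp (- c\<^sup>2 / 2) * E_proj k A xs y + \<epsilon>"
        using F(2)[OF True] unfolding \<epsilon>_def c_def[symmetric] by linarith
    next
      case False
      \<comment> \<open>The ratio is 0 by the convention for division by zero and the expectation is
        0 as well, so the bound reduces to 0 <= p + \<epsilon>.\<close>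
      then have "\<mu> A = 0" by (simp add: \<mu>_def zero_less_measure_iff)
      then show "\<mu> (per_region C l k ?R (xs @ [y])) / \<mu> A
          \<le> p - sqrt (real k / (2 * pi)) * exp (- c\<^sup>2 / 2) * E_proj k A xs y + \<epsilon>"
        using F(3) p e0 by simp
    qed
  qed
  show ?coQ
  proof -
    let ?R = "\<lambda>v. \<not> v \<le> - c / sqrt k"
    define A where "A = per_region C l k ?R xs"
    have "{v. ?R v} \<in> sets borel" by (simp add: not_le)
    note F = per_region_fraction[OF xs perf this k d eta alpha p, folded c_def, folded A_def \<mu>_def]
    have sub: "per_region C l k ?R (xs @ [y]) \<subseteq> A - {z \<in> A. ip k y z \<le> - c / sqrt k}"
      using per_region_append_subset[OF xs perf, of ?R] unfolding A_def by blast
    have Q: "co_Q_ratio C l k p xs y = \<mu> (per_region C l k ?R (xs @ [y])) / \<mu> A"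
      by (simp add: co_Q_ratio_def co_P_per_def co_N_per_eq[OF xs] co_N_per_eq[OF xs'] A_def \<mu>_def c_def)
    show ?thesis
      unfolding co_N_per_eq[OF xs] Q c_def[symmetric] A_def[symmetric]
    proof (cases "\<mu> A > 0")
      case True
      have "\<mu> (per_region C l k ?R (xs @ [y])) / \<mu> A \<le> \<mu> (A - {z \<in> A. ip k y z \<le> - c / sqrt k}) / \<mu> A"
        using True unfolding \<mu>_def by (intro divide_right_mono sphere.finite_measure_mono sub sets.Diff ipm F(1)) auto
      also have "\<mu> (A - {z \<in> A. ip k y z \<le> - c / sqrt k}) = \<mu> A - \<mu> {z \<in> A. ip k y z \<le> - c / sqrt k}"
        unfolding \<mu>_def by (intro sphere.finite_measure_Diff ipm F(1)) auto
      also have "\<dots> / \<mu> A = 1 - \<mu> {z \<in> A. ip k y z \<le> - c / sqrt k} / \<mu> A"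
        using True by (simp add: diff_divide_distrib)
      finally show "\<mu> (per_region C l k ?R (xs @ [y])) / \<mu> A
          \<le> 1 - p + sqrt (real k / (2 * pi)) * exp (- c\<^sup>2 / 2) * E_proj k A xs y + \<epsilon>"
        using F(2)[OF True] unfolding \<epsilon>_def c_def[symmetric] by linarith
    next
      case False
      then have "\<mu> A = 0" by (simp add: \<mu>_def zero_less_measure_iff)
      then show "\<mu> (per_region C l k ?R (xs @ [y])) / \<mu> A
          \<le> 1 - p + sqrt (real k / (2 * pi)) * exp (- c\<^sup>2 / 2) * E_proj k A xs y + \<epsilon>"
        using F(3) p e0 by simp
    qed
  qed
qed

section \<open>Choice of the constants and order of the quantifiers\<close>

theorem theorem6p2:
  fixes C :: real
  assumes "C > 1"
  shows "\<exists>(K :: real \<Rightarrow> real) (D0 :: real). \<forall>D\<ge>D0. \<exists>l0 :: nat. \<forall>l\<ge>l0.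
    \<forall>(k :: nat) (p :: real) (xs :: (nat \<Rightarrow> real) list) (y :: nat \<Rightarrow> real).
      real k = D\<^sup>2 * (real l)\<^sup>2 \<and> p_C C < p \<and> p < 1/2 \<and>
      length xs \<ge> 1 \<and> real (length xs + 1) \<le> C * real l \<and> perfect C l k (xs @ [y])
      \<longrightarrow>
      Q_ratio C l k p xs y
        \<le> p - sqrt (real k / (2 * pi)) * exp (- (c_const k p)\<^sup>2 / 2) * E_proj k (N_per C l k p xs) xs y
            + K p / D\<^sup>2 \<and>
      co_Q_ratio C l k p xs y
        \<le> 1 - p + sqrt (real k / (2 * pi)) * exp (- (c_const k p)\<^sup>2 / 2) * E_proj k (co_N_per C l k p xs) xs y
            + K p / D\<^sup>2"
proof -
  define \<alpha> where "\<alpha> = alpha_C C"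
  define q where "q = p_C C"
  have q: "0 < q" "q < 1/2" using p_C_properties[OF assms] by (simp_all add: q_def)
  \<comment> \<open>The future bound m on c, depending on C alone: \<Phi>(-m) stays below q/2, which
    leaves q/2 for the approximation errors since p > q.\<close>
  have "((\<lambda>m. cdf std_normal_distribution (- real m)) \<longlonglongrightarrow> 0)"
    by (rule std_normal.cdf_lim_neg_infty)
  then obtain m0 :: nat where m0: "cdf std_normal_distribution (- real m0) < q / 2"
    using order_tendstoD(2)[of _ 0 sequentially "q / 2"] q(1) by (auto simp: eventually_sequentially)
  define m where "m = real m0"
  have m: "m \<ge> 0" "cdf std_normal_distribution (- m) < q / 2" using m0 by (simp_all add: m_def)
  \<comment> \<open>One unit each for 2 \<eta> and for the \<delta> term; \<alpha>^4 is the Taylor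
    remainder (\<alpha>^2 / D)^2 multiplied by D^2.\<close>
  define K where "K = (\<lambda>_::real. 2 + \<alpha>^4)"
  \<comment> \<open>D >= \<alpha>^2 gives |t| <= 1; D >= 4/q makes 2/D at most q/2, the room left
    for the errors in the bound on c.\<close>
  define D0 where "D0 = max 1 (max (\<alpha>\<^sup>2) (4 / q))"
  show ?thesis
  proof (intro exI[of _ K] exI[of _ D0] allI impI)
    fix D assume "D \<ge> D0"
    then have D: "D \<ge> 1" "\<alpha>\<^sup>2 \<le> D" "4 / q \<le> D" by (simp_all add: D0_def)
    \<comment> \<open>\<eta> and \<delta> depend on D but not on l: 2 \<eta> = 1/D^2, and 8m + 4 = 4
      (2m + 1) makes the \<delta> term at most 1/D^2 once c <= m. The cap 1/10 is the range of the
      half-space estimate.\<close>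
    define \<eta> where "\<eta> = 1 / (2 * D\<^sup>2)"
    define \<delta> where "\<delta> = min (1 / 10) (1 / (D\<^sup>2 * (8 * m + 4)))"
    have eta0: "\<eta> > 0" using D by (simp add: \<eta>_def)
    have d: "\<delta> > 0" "\<delta> \<le> 1 / 10" "\<delta> \<le> 1 / (D\<^sup>2 * (8 * m + 4))" using D m by (simp_all add: \<delta>_def add_nonneg_pos)
    have dm: "4 * \<delta> * (2 * m + 1) \<le> 1 / D\<^sup>2"
    proof -
      have "4 * \<delta> * (2 * m + 1) = \<delta> * (8 * m + 4)" by (simp add: algebra_simps)
      also have "\<dots> \<le> 1 / (D\<^sup>2 * (8 * m + 4)) * (8 * m + 4)" using d(3) m by (intro mult_right_mono) auto
      also have "\<dots> = 1 / D\<^sup>2" using m by simp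
      finally show ?thesis .
    qed
    have small: "\<eta> + 4 * \<delta> * m \<le> q / 2"
    proof -
      have "4 * \<delta> * m \<le> 4 * \<delta> * (2 * m + 1)" using d m by (intro mult_left_mono) auto
      also note dm
      finally have "\<eta> + 4 * \<delta> * m \<le> 3 / (2 * D\<^sup>2)" by (simp add: \<eta>_def)
      also have "\<dots> \<le> 2 / D\<^sup>2" using D by (simp add: field_simps)
      also have "\<dots> \<le> 2 / D" using D by (intro divide_left_mono) (auto simp: power2_eq_square)
      also have "\<dots> \<le> q / 2" using D q by (simp add: field_simps)
      finally show ?thesis .
    qed
    \<comment> \<open>Since k >= l^2 >= l, the entries after 1 ensure in turn: \<delta> k >= 2; the
      norm fluctuation is at most \<eta>/2; so is the projection term, where the length of the list
      is below C l; and \<alpha>^2 l / k <= \<delta>.\<close>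
    define L where "L = max 1 (max (2 / \<delta>) (max (32 / (\<delta>\<^sup>2 * \<eta>)) (max (4 * C / (\<delta> * \<eta>)) (\<alpha>\<^sup>2 / \<delta>))))"
    show "\<exists>l0 :: nat. \<forall>l\<ge>l0. \<forall>(k :: nat) (p :: real) (xs :: (nat \<Rightarrow> real) list) (y :: nat \<Rightarrow> real).
      real k = D\<^sup>2 * (real l)\<^sup>2 \<and> p_C C < p \<and> p < 1/2 \<and>
      length xs \<ge> 1 \<and> real (length xs + 1) \<le> C * real l \<and> perfect C l k (xs @ [y])
      \<longrightarrow>
      Q_ratio C l k p xs y
        \<le> p - sqrt (real k / (2 * pi)) * exp (- (c_const k p)\<^sup>2 / 2) * E_proj k (N_per C l k p xs) xs y
            + K p / D\<^sup>2 \<and>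
      co_Q_ratio C l k p xs y
        \<le> 1 - p + sqrt (real k / (2 * pi)) * exp (- (c_const k p)\<^sup>2 / 2) * E_proj k (co_N_per C l k p xs) xs y
            + K p / D\<^sup>2"
    proof (intro exI[of _ "nat \<lceil>L\<rceil>"] allI impI)
      fix l k :: nat and p :: real and xs y
      assume "l \<ge> nat \<lceil>L\<rceil>"
      then have "L \<le> real l" by linarith
      then have l: "real l \<ge> 1" "2 / \<delta> \<le> real l" "32 / (\<delta>\<^sup>2 * \<eta>) \<le> real l" "4 * C / (\<delta> * \<eta>) \<le> real l" "\<alpha>\<^sup>2 / \<delta> \<le> real l"
        by (simp_all add: L_def)
      assume H: "real k = D\<^sup>2 * (real l)\<^sup>2 \<and> p_C C < p \<and> p < 1/2 \<and>
        length xs \<ge> 1 \<and> real (length xs + 1) \<le> C * real l \<and> perfect C l k (xs @ [y])"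
      have p: "q < p" "0 < p" "p < 1/2" using H q by (auto simp: q_def)
      have xs: "xs \<noteq> []" using H by auto
      \<comment> \<open>The relation between k, D and l enters here: it turns the bound \<alpha>^2 l
        / sqrt k on |t| into \<alpha>^2 / D.\<close>
      have sk: "sqrt (real k) = D * real l" using H D by (simp add: real_sqrt_mult)
      have ll: "real l \<le> (real l)\<^sup>2" using l(1) by (simp add: power2_eq_square mult_le_cancel_left1)
      have DD: "1 \<le> D\<^sup>2" using D(1) by simp
      have kl2: "(real l)\<^sup>2 \<le> real k" using H DD mult_right_mono[OF DD, of "(real l)\<^sup>2"] by simp
      with ll have kl: "real l \<le> real k" by linarith
      then have k: "k \<ge> 1" using l(1) by simp
      have dk: "\<delta> * real k \<ge> 2"
      proof -
        have "2 \<le> \<delta> * real l" using l(2) d(1) by (simp add: divide_le_eq mult.commute)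
        also have "\<dots> \<le> \<delta> * real k" using kl d(1) by (intro mult_left_mono) auto
        finally show ?thesis .
      qed
      have eta: "16 / (\<delta>\<^sup>2 * real k) + 2 * real (length xs) / (\<delta> * real k) \<le> \<eta>"
      proof -
        have "16 / (\<delta>\<^sup>2 * real k) \<le> 16 / (\<delta>\<^sup>2 * real l)"
          using kl d(1) l(1) k by (intro divide_left_mono mult_left_mono mult_pos_pos) auto
        also have "\<dots> \<le> \<eta> / 2"
          using l(1,3) d(1) eta0 by (simp add: field_simps)
        finally have 1: "16 / (\<delta>\<^sup>2 * real k) \<le> \<eta> / 2" .
        have "2 * real (length xs) / (\<delta> * real k) \<le> 2 * (C * real l) / (\<delta> * (real l)\<^sup>2)"
          using H kl2 d(1) l(1) by (intro frac_le mult_left_mono) auto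
        also have "\<dots> = 2 * C / (\<delta> * real l)" using l(1) by (simp add: power2_eq_square)
        also have "\<dots> \<le> \<eta> / 2" using l(1,4) d(1) eta0 by (simp add: field_simps)
        finally show ?thesis using 1 by linarith
      qed
      have a1: "(alpha_C C)\<^sup>2 * real l / real k \<le> \<delta>"
      proof -
        have "\<alpha>\<^sup>2 * real l / real k \<le> \<alpha>\<^sup>2 * real l / (real l)\<^sup>2"
          using kl2 l(1) k by (intro divide_left_mono mult_pos_pos) auto
        also have "\<dots> = \<alpha>\<^sup>2 / real l" using l(1) by (simp add: power2_eq_square)
        also have "\<dots> \<le> \<delta>" using l(1,5) d(1) by (simp add: field_simps)
        finally show ?thesis by (simp add: \<alpha>_def)
      qed
      have a2: "(alpha_C C)\<^sup>2 * real l / sqrt (real k) \<le> \<alpha>\<^sup>2 / D"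
        unfolding sk using l(1) by (simp add: \<alpha>_def)
      have a3: "\<alpha>\<^sup>2 / D \<le> 1" using D by simp
      have "16 / (\<delta>\<^sup>2 * real k) \<le> \<eta>"
        using eta d(1) by (smt (verit) divide_nonneg_nonneg mult_nonneg_nonneg of_nat_0_le_iff)
      moreover have "cdf std_normal_distribution (- m) + \<eta> + 4 * \<delta> * m < p"
        using m(2) small p(1) by linarith
      ultimately have c: "c_const k p \<le> m"
        using k d(1,2) dk p(2,3) m(1) by (intro c_const_le)
      have "2 * \<eta> + 4 * \<delta> * (2 * c_const k p + 1) + (\<alpha>\<^sup>2 / D)\<^sup>2 \<le> K p / D\<^sup>2"
      proof -
        have "4 * \<delta> * (2 * c_const k p + 1) \<le> 4 * \<delta> * (2 * m + 1)" using c d(1) by (intro mult_left_mono) auto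
        moreover have "2 * \<eta> = 1 / D\<^sup>2" by (simp add: \<eta>_def)
        moreover have "(\<alpha>\<^sup>2 / D)\<^sup>2 = \<alpha>^4 / D\<^sup>2" by (simp add: power_divide)
        moreover have "K p / D\<^sup>2 = 1 / D\<^sup>2 + 1 / D\<^sup>2 + \<alpha>^4 / D\<^sup>2" by (simp add: K_def add_divide_distrib)
        ultimately show ?thesis using dm by linarith
      qed
      moreover note Q_ratio_bounds[OF xs _ k d(1,2) dk eta a1 a2 a3 p(2,3), of y]
      ultimately show "Q_ratio C l k p xs y
        \<le> p - sqrt (real k / (2 * pi)) * exp (- (c_const k p)\<^sup>2 / 2) * E_proj k (N_per C l k p xs) xs y
            + K p / D\<^sup>2 \<and>
      co_Q_ratio C l k p xs y
        \<le> 1 - p + sqrt (real k / (2 * pi)) * exp (- (c_const k p)\<^sup>2 / 2) * E_proj k (co_N_per C l k p xs) xs y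
            + K p / D\<^sup>2"
        using H by fastforce
    qed
  qed
qed

end
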